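(* Let $D\subseteq\mathbb{Z}^2$ be a finite shape and $b,a$ non-negative integers such that the Laurent polynomial $g=f_D-(b-a)$ has no line polynomial factors. Then the set $\mathcal{S}(D,b,a)$ of all $(D,b,a)$-coverings is finite, and one can effectively construct all of its (finitely many) elements.
   Context: Write $X^{\vec{u}}=x^{u_1}y^{u_2}$. The characteristic polynomial of a finite $D\subseteq\mathbb{Z}^2$ is $f_D=\sum_{\vec{u}\in D}X^{-\vec{u}}$. A line polynomial is a Laurent polynomial whose support (set of exponents with non-zero coefficients) has at least two points, all lying on a single line $\vec{u}+\mathbb{Q}\vec{v}$; factors are taken in $\mathbb{C}[x^{\pm1},y^{\pm1}]$. A $(D,b,a)$-covering is a configuration $c\in\{0,1\}^{\mathbb{Z}^2}$ such that for every $\vec{u}\in\mathbb{Z}^2$ the restriction $c|_{\vec{u}+D}$ contains exactly $b$ ones if $c_{\vec{u}}=1$ and exactly $a$ ones if $c_{\vec{u}}=0$. ($\mathcal{S}(D,b,a)$ is a subshift of finite type; its elements, when finitely many, are two-periodic configurations and thus finitely describable.) *)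

theory Defs
  imports Complex_Main "HOL-Library.Poly_Mapping" "HOL-Library.Product_Plus"
    "HOL-Library.Nat_Bijection"
begin

text \<open>
  \<open>\<complex>[x\<^sup>\<plusminus>\<^sup>1, y\<^sup>\<plusminus>\<^sup>1]\<close> is the group ring of \<open>\<int>\<^sup>2\<close>: a finitely supported map from exponents to
  coefficients, multiplied by convolution.  Divisibility is the ring-theoretic \<open>dvd\<close>.
\<close>

type_synonym laurent = "(int \<times> int) \<Rightarrow>\<^sub>0 complex"

definition characteristic_polynomial :: "(int \<times> int) set \<Rightarrow> laurent" where
  "characteristic_polynomial D = (\<Sum>u\<in>D. Poly_Mapping.single (- u) 1)"

definition rational_line :: "int \<times> int \<Rightarrow> int \<times> int \<Rightarrow> (int \<times> int) set" where
  "rational_line u v =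
     {w. \<exists>q :: rat. of_int (fst w) = of_int (fst u) + q * of_int (fst v) \<and>
                    of_int (snd w) = of_int (snd u) + q * of_int (snd v)}"

definition line_polynomial :: "laurent \<Rightarrow> bool" where
  "line_polynomial h \<longleftrightarrow>
     card (Poly_Mapping.keys h) \<ge> 2 \<and> (\<exists>u v. Poly_Mapping.keys h \<subseteq> rational_line u v)"

type_synonym config = "int \<times> int \<Rightarrow> nat"

definition coverings :: "(int \<times> int) set \<Rightarrow> nat \<Rightarrow> nat \<Rightarrow> config set" where
  "coverings D b a =
     {c. range c \<subseteq> {0, 1} \<and>
         (\<forall>u. (c u = 1 \<longrightarrow> card {w \<in> (+) u ` D. c w = 1} = b) \<and>
              (c u = 0 \<longrightarrow> card {w \<in> (+) u ` D. c w = 1} = a))}"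

text \<open>
  Kleene's partial recursive functions, as programs acting on lists of natural number arguments.
  A program that is applied to a list of unsuitable length, or that does not halt, has no result.
\<close>

datatype recf = Zero | Succ | Proj nat | Comp recf "recf list" | PrimRec recf recf | Mu recf

inductive computes :: "recf \<Rightarrow> nat list \<Rightarrow> nat \<Rightarrow> bool" where
  Zero: "computes Zero xs 0"
| Succ: "computes Succ [x] (Suc x)"
| Proj: "i < length xs \<Longrightarrow> computes (Proj i) xs (xs ! i)"
| Comp: "list_all2 (\<lambda>g y. computes g xs y) gs ys \<Longrightarrow> computes f ys z
           \<Longrightarrow> computes (Comp f gs) xs z"
| PrimRec_0: "computes f xs y \<Longrightarrow> computes (PrimRec f g) (0 # xs) y"
| PrimRec_Suc: "computes (PrimRec f g) (n # xs) y \<Longrightarrow> computes g (n # y # xs) z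
           \<Longrightarrow> computes (PrimRec f g) (Suc n # xs) z"
| Mu: "\<forall>i<n. \<exists>y>0. computes f (i # xs) y \<Longrightarrow> computes f (n # xs) 0
           \<Longrightarrow> computes (Mu f) xs n"

inductive_cases computes_ZeroE: "computes Zero xs y"
inductive_cases computes_SuccE: "computes Succ xs y"
inductive_cases computes_ProjE: "computes (Proj i) xs y"
inductive_cases computes_CompE: "computes (Comp f gs) xs y"
inductive_cases computes_PrimRec_0E: "computes (PrimRec f g) (0 # xs) y"
inductive_cases computes_PrimRec_SucE: "computes (PrimRec f g) (Suc n # xs) y"
inductive_cases computes_MuE: "computes (Mu f) xs y"

lemma computes_deterministic:
  "computes f xs y \<Longrightarrow> computes f xs z \<Longrightarrow> y = z"
proof (induction arbitrary: z rule: computes.induct)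
  case (Zero xs)
  then show ?case by (rule computes_ZeroE) simp
next
  case (Succ x)
  then show ?case by (rule computes_SuccE) simp
next
  case (Proj i xs)
  from Proj.prems show ?case by (rule computes_ProjE) simp
next
  case (Comp xs gs ys f w)
  from Comp.prems obtain zs where
    zs: "list_all2 (\<lambda>g y. computes g xs y) gs zs" "computes f zs z"
    by (rule computes_CompE)
  have "ys = zs"
  proof (rule nth_equalityI)
    show "length ys = length zs"
      using Comp.IH(1) zs(1) by (simp add: list_all2_conv_all_nth)
    show "ys ! i = zs ! i" if "i < length ys" for i
      using Comp.IH(1) zs(1) that by (simp add: list_all2_conv_all_nth)
  qed
  then show ?case using Comp.IH(2) zs(2) by blast
next
  case (PrimRec_0 f xs y g)
  from PrimRec_0.prems have "computes f xs z" by (rule computes_PrimRec_0E)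
  then show ?case by (rule PrimRec_0.IH)
next
  case (PrimRec_Suc f g n xs y w)
  from PrimRec_Suc.prems obtain y' where
    y': "computes (PrimRec f g) (n # xs) y'" "computes g (n # y' # xs) z"
    by (rule computes_PrimRec_SucE)
  from PrimRec_Suc.IH(1)[OF y'(1)] y'(2) have "computes g (n # y # xs) z" by simp
  then show ?case by (rule PrimRec_Suc.IH(2))
next
  case (Mu n f xs)
  from Mu.prems have z: "\<forall>i<z. \<exists>y>0. computes f (i # xs) y" "computes f (z # xs) 0"
    by (blast elim: computes_MuE)+
  have "\<not> n < z"
  proof
    assume "n < z"
    with z(1) obtain y where "y > 0" "computes f (n # xs) y" by blast
    with Mu.IH(2)[of y] show False by simp
  qed
  moreover have "\<not> z < n"
  proof
    assume "z < n"
    with Mu.IH(1) obtain y where "y > 0" "\<forall>x. computes f (z # xs) x \<longrightarrow> y = x" by blast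
    with z(2) show False by simp
  qed
  ultimately show ?case by simp
qed

definition encode_shape :: "(int \<times> int) list \<Rightarrow> nat" where
  "encode_shape ds =
     list_encode (map (\<lambda>(i, j). prod_encode (int_encode i, int_encode j)) ds)"

text \<open>
  A two-periodic configuration has positive horizontal and vertical periods \<open>p\<close> and \<open>q\<close>, and is
  given by these and by the cells of the \<open>p \<times> q\<close> fundamental rectangle that carry a one.
\<close>

type_synonym description = "nat \<times> nat \<times> (nat \<times> nat) list"

fun valid_description :: "description \<Rightarrow> bool" where
  "valid_description (p, q, cells) \<longleftrightarrow>
     p > 0 \<and> q > 0 \<and> set cells \<subseteq> {..<p} \<times> {..<q}"

fun described_config :: "description \<Rightarrow> config" where
  "described_config (p, q, cells) =
     (\<lambda>(i, j). if (nat (i mod int p), nat (j mod int q)) \<in> set cells then 1 else 0)"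

fun encode_description :: "description \<Rightarrow> nat" where
  "encode_description (p, q, cells) =
     prod_encode (p, prod_encode (q, list_encode (map prod_encode cells)))"

definition encode_descriptions :: "description list \<Rightarrow> nat" where
  "encode_descriptions ps = list_encode (map encode_description ps)"

end

theory Submission
  imports Defs "HOL-Library.FuncSet" "HOL-Computational_Algebra.Fundamental_Theorem_Algebra"
begin

text \<open>
  The difference \<open>e\<close> of two coverings takes values in \<open>{-1, 0, 1}\<close> and is annihilated by
  \<open>g = \<Sum>v. g\<^sub>v X\<^sup>v\<close>. As \<open>g\<^sup>p \<equiv> g(X\<^sup>p)\<close> modulo a prime \<open>p\<close>, the values of \<open>g(X\<^sup>p) e\<close> are divisible by
  \<open>p\<close> and, for large \<open>p\<close>, smaller than \<open>p\<close>, so \<open>g(X\<^sup>p) e = 0\<close>. Iterating, \<open>g(X\<^sup>k) e = 0\<close> for all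
  \<open>k \<equiv> 1\<close> modulo a suitable factorial \<open>r\<close>, and a Vandermonde elimination in the group ring turns these
  equations into \<open>\<Prod>v\<noteq>w. (X\<^sup>r\<^sup>w - X\<^sup>r\<^sup>v) e = 0\<close>. Over \<open>\<complex>\<close> each factor splits into factors
  \<open>X\<^sup>u - \<zeta>\<close> with \<open>u\<close> primitive, up to monomials. On the kernel of such a factor \<open>g\<close> acts as a linear
  recurrence in one variable, which is nontrivial because the line polynomial \<open>X\<^sup>u - \<zeta>\<close> does not
  divide \<open>g\<close>. Hence \<open>e\<close> is determined by its values on a finite window that does not depend on \<open>e\<close>,
  and there are only finitely many \<open>e\<close>.

  Being permuted by the translations, the finitely many coverings have a common period. By
  compactness a sufficiently large finite window certifies that a given list of periodic coverings is
  complete. Certificates can be checked by a computable function, so an unbounded search finds one.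
\<close>

section \<open>Configurations annihilated by a Laurent polynomial\<close>

text \<open>The convolution action that makes functions on the group a module over the group ring.
  The monomial \<open>X^v\<close> shifts by \<open>v\<close>, so
  \<open>characteristic_polynomial D\<close> acts by summing a configuration over
  \<open>u + D\<close>.\<close>

definition act :: "('g::ab_group_add \<Rightarrow>\<^sub>0 'a::comm_ring_1) \<Rightarrow> ('g \<Rightarrow> 'a) \<Rightarrow> 'g \<Rightarrow> 'a" where
  "act f h = (\<lambda>u. \<Sum>v\<in>Poly_Mapping.keys f. Poly_Mapping.lookup f v * h (u - v))"

lemma act_superset:
  assumes "finite S" "Poly_Mapping.keys f \<subseteq> S"
  shows "act f h u = (\<Sum>v\<in>S. Poly_Mapping.lookup f v * h (u - v))"
  unfolding act_def by (rule sum.mono_neutral_left) (use assms in \<open>auto simp: in_keys_iff\<close>)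

lemma act_zero [simp]: "act 0 h = (\<lambda>_. 0)"
  by (simp add: act_def)

lemma act_add: "act (f + g) h u = act f h u + act g h u"
proof -
  let ?S = "Poly_Mapping.keys f \<union> Poly_Mapping.keys g"
  have "Poly_Mapping.keys (f + g) \<subseteq> ?S"
    by (rule Poly_Mapping.keys_add)
  then show ?thesis
    by (simp add: act_superset[where S = ?S] lookup_add distrib_right sum.distrib)
qed

lemma act_single [simp]: "act (Poly_Mapping.single v a) h = (\<lambda>u. a * h (u - v))"
  by (rule ext) (subst act_superset[where S = "{v}"], auto)

lemma act_sum: "act (\<Sum>i\<in>I. f i) h u = (\<Sum>i\<in>I. act (f i) h u)"
  by (induction I rule: infinite_finite_induct) (simp_all add: act_add)

lemma act_uminus: "act (- f) h u = - act f h u"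
  using act_add[of f "- f" h u] by (simp add: eq_neg_iff_add_eq_0 add.commute)

lemma act_diff: "act (f - g) h u = act f h u - act g h u"
  using act_add[of f "- g" h u] by (simp add: act_uminus)

lemma poly_mapping_sum_single:
  "f = (\<Sum>v\<in>Poly_Mapping.keys f. Poly_Mapping.single v (Poly_Mapping.lookup f v))"
  by (rule poly_mapping_eqI)
     (auto simp: lookup_sum lookup_single when_def sum.If_cases in_keys_iff)

lemma act_fun_diff: "act f (\<lambda>u. h u - h' u) u = act f h u - act f h' u"
  unfolding act_def by (simp add: right_diff_distrib sum_subtractf)

lemma act_fun_zero [simp]: "act f (\<lambda>_. 0) = (\<lambda>_. 0)"
  by (simp add: act_def)

lemma act_mult: "act (f * g) h = act f (act g h)"
proof
  fix u
  let ?F = "\<lambda>v. Poly_Mapping.single v (Poly_Mapping.lookup f v)"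
  let ?G = "\<lambda>v. Poly_Mapping.single v (Poly_Mapping.lookup g v)"
  let ?K = "Poly_Mapping.keys f" and ?L = "Poly_Mapping.keys g"
  have "f * g = (\<Sum>v\<in>?K. ?F v) * (\<Sum>w\<in>?L. ?G w)"
    by (simp flip: poly_mapping_sum_single)
  also have "\<dots> = (\<Sum>v\<in>?K. \<Sum>w\<in>?L. ?F v * ?G w)"
    by (rule sum_product)
  finally have "act (f * g) h u =
      (\<Sum>v\<in>?K. \<Sum>w\<in>?L. Poly_Mapping.lookup f v * (Poly_Mapping.lookup g w * h (u - (v + w))))"
    by (simp add: act_sum mult_single mult.assoc)
  also have "\<dots> = act f (act g h) u"
    by (simp add: act_def sum_distrib_left diff_diff_eq)
  finally show "act (f * g) h u = act f (act g h) u" .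
qed

lemma act_commute: "act f (act g h) = act g (act f h)"
  by (simp flip: act_mult add: mult.commute)

lemma act_power_eq_zero:
  fixes e :: "'g::ab_group_add \<Rightarrow> 'a::comm_ring_1"
  assumes "act f e = (\<lambda>_. 0)" "n > 0"
  shows "act (f ^ n) e = (\<lambda>_. 0)"
  using assms by (cases n) (simp_all add: act_mult act_commute[of f])

section \<open>Congruences modulo a prime\<close>

text \<open>The inner binomial coefficients are divisible by \<open>p\<close>. An arbitrary
  commutative ring is allowed because both the integers and the integral group ring are
  needed.\<close>

lemma prime_dvd_add_power:
  fixes x y :: "'a::comm_ring_1"
  assumes "prime p"
  shows "of_nat p dvd (x + y) ^ p - (x ^ p + y ^ p)"
proof -
  have p: "p > 0" using assms prime_gt_0_nat by blast
  have "(x + y) ^ p = (\<Sum>k\<le>p. of_nat (p choose k) * x ^ k * y ^ (p - k))"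
    by (rule binomial_ring)
  also have "{..p} = insert 0 (insert p {0<..<p})" using p by auto
  also have "(\<Sum>k\<in>\<dots>. of_nat (p choose k) * x ^ k * y ^ (p - k)) =
     x ^ p + y ^ p + (\<Sum>k\<in>{0<..<p}. of_nat (p choose k) * x ^ k * y ^ (p - k))"
    using p by simp
  finally have "(x + y) ^ p - (x ^ p + y ^ p) =
     (\<Sum>k\<in>{0<..<p}. of_nat (p choose k) * x ^ k * y ^ (p - k))" by simp
  moreover have "of_nat p dvd (of_nat (p choose k) * x ^ k * y ^ (p - k) :: 'a)"
    if "k \<in> {0<..<p}" for k
    proof -
    have "p dvd (p choose k)" using that assms by (intro dvd_choose_prime) auto
    then obtain m where "p choose k = p * m" by (elim dvdE)
    then show ?thesis by (simp add: mult.assoc)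
  qed
  ultimately show ?thesis by (simp only: dvd_sum)
qed

lemma prime_dvd_sum_power:
  fixes x :: "'i \<Rightarrow> 'a::comm_ring_1"
  assumes "prime p"
  shows "of_nat p dvd (\<Sum>i\<in>I. x i) ^ p - (\<Sum>i\<in>I. x i ^ p)"
proof (induction I rule: infinite_finite_induct)
  case (insert i I)
  have "of_nat p dvd ((x i + (\<Sum>i\<in>I. x i)) ^ p - (x i ^ p + (\<Sum>i\<in>I. x i) ^ p)) +
     ((\<Sum>i\<in>I. x i) ^ p - (\<Sum>i\<in>I. x i ^ p))"
    by (intro dvd_add prime_dvd_add_power assms insert)
  then show ?case using insert by (simp add: algebra_simps)
qed (use prime_gt_0_nat[OF assms] in \<open>simp_all add: power_0_left\<close>)

text \<open>Fermat's little theorem: a nonnegative integer is a sum of ones, and a negative one is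
  reduced to its opposite through \<open>(a + (- a)) ^ p = 0\<close>, without regard to the parity
  of \<open>p\<close>.\<close>

lemma prime_dvd_power_minus_self:
  fixes a :: int
  assumes "prime p"
  shows "int p dvd a ^ p - a"
proof -
  have nat: "int p dvd int n ^ p - int n" for n
    using prime_dvd_sum_power[OF assms, of "\<lambda>_. 1 :: int" "{..<n}"] by simp
  show ?thesis
  proof (cases "a \<ge> 0")
    case True
    then show ?thesis using nat[of "nat a"] by simp
  next
    case False
    have "int p dvd - (a ^ p + (- a) ^ p)"
      using prime_dvd_add_power[OF assms, of a "- a"] prime_gt_0_nat[OF assms]
      by (simp add: power_0_left)
    then have "int p dvd a ^ p + (- a) ^ p"
      by (simp only: dvd_minus_iff)
    moreover have "int p dvd (- a) ^ p - (- a)"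
      using nat[of "nat (- a)"] False by simp
    ultimately have "int p dvd (a ^ p + (- a) ^ p) - ((- a) ^ p - (- a))"
      by (rule dvd_diff)
    then show ?thesis by simp
  qed
qed

section \<open>Dilations of an annihilator\<close>

definition scale :: "int \<Rightarrow> int \<times> int \<Rightarrow> int \<times> int" where
  "scale k v = (k * fst v, k * snd v)"

lemma scale_simps [simp]:
  "scale 0 v = 0" "scale 1 v = v" "fst (scale k v) = k * fst v" "snd (scale k v) = k * snd v"
  by (simp_all add: scale_def zero_prod_def)

lemma scale_diff: "scale (j - k) v = scale j v - scale k v"
  by (simp add: scale_def prod_eq_iff left_diff_distrib)

lemma scale_uminus: "scale (- k) v = - scale k v"
  by (simp add: scale_def prod_eq_iff)

lemma scale_scale: "scale j (scale k v) = scale (j * k) v"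
  by (simp add: scale_def prod_eq_iff)

lemma power_single:
  "Poly_Mapping.single v (a::'a::comm_ring_1) ^ n = Poly_Mapping.single (scale (int n) v) (a ^ n)"
proof (induction n)
  case 0
  show ?case by (simp flip: single_one)
next
  case (Suc n)
  have "v + scale (int n) v = scale (int (Suc n)) v"
    by (simp add: scale_def prod_eq_iff algebra_simps)
  then show ?case by (simp add: Suc mult_single)
qed

text \<open>The \<open>p\<close>-th power of the annihilator is congruent to its dilation modulo
  \<open>p\<close>, so the sums in question are multiples of \<open>p\<close>; being smaller than
  \<open>p\<close> in absolute value, they vanish. Indexing the exponents by \<open>g\<close> lets
  the statement be applied to its own conclusion with the same coefficients.\<close>

lemma dilate_prime:
  fixes a :: "'i \<Rightarrow> int" and e :: "int \<times> int \<Rightarrow> int"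
  assumes S: "finite S" and p: "prime p" "(\<Sum>i\<in>S. \<bar>a i\<bar>) < int p"
    and e: "\<And>u. \<bar>e u\<bar> \<le> 1" and ann: "\<And>u. (\<Sum>i\<in>S. a i * e (u - g i)) = 0"
  shows "(\<Sum>i\<in>S. a i * e (u - scale (int p) (g i))) = 0"
proof -
  define f where "f = (\<Sum>i\<in>S. Poly_Mapping.single (g i) (a i))"
  have "act f e = (\<lambda>_. 0)"
    by (rule ext) (simp add: f_def act_sum ann)
  then have fp: "act (f ^ p) e = (\<lambda>_. 0)"
    using p prime_gt_0_nat by (intro act_power_eq_zero) auto
  \<comment> \<open>The quotient \<open>q\<close> has integer coefficients, so
    \<open>act q e\<close> is integer valued and its multiple by \<open>p\<close> is divisible by
    \<open>p\<close>.\<close>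
  obtain q where q: "f ^ p - (\<Sum>i\<in>S. Poly_Mapping.single (g i) (a i) ^ p) = of_nat p * q"
    using prime_dvd_sum_power[OF p(1), of "\<lambda>i. Poly_Mapping.single (g i) (a i)" S]
    unfolding f_def by (elim dvdE) blast
  then have "(\<Sum>i\<in>S. Poly_Mapping.single (g i) (a i) ^ p) = f ^ p - of_nat p * q"
    by (simp add: algebra_simps)
  then have "act (\<Sum>i\<in>S. Poly_Mapping.single (g i) (a i) ^ p) e u = - (int p * act q e u)"
    by (simp add: act_diff fp act_mult flip: single_of_nat)
  then have "int p dvd (\<Sum>i\<in>S. a i ^ p * e (u - scale (int p) (g i)))"
    by (simp add: act_sum power_single)
  \<comment> \<open>Fermat's theorem replaces the coefficients \<open>a i ^ p\<close> by
    \<open>a i\<close>.\<close>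
  moreover have "int p dvd (\<Sum>i\<in>S. (a i ^ p - a i) * e (u - scale (int p) (g i)))"
    by (intro dvd_sum dvd_mult2 prime_dvd_power_minus_self p)
  ultimately have "int p dvd (\<Sum>i\<in>S. a i ^ p * e (u - scale (int p) (g i))) -
      (\<Sum>i\<in>S. (a i ^ p - a i) * e (u - scale (int p) (g i)))"
    by (rule dvd_diff)
  then have "int p dvd (\<Sum>i\<in>S. a i * e (u - scale (int p) (g i)))"
    by (simp add: left_diff_distrib sum_subtractf)
  moreover have "\<bar>\<Sum>i\<in>S. a i * e (u - scale (int p) (g i))\<bar> \<le> (\<Sum>i\<in>S. \<bar>a i\<bar>)"
    by (rule order_trans[OF sum_abs sum_mono])
       (use e in \<open>simp add: abs_mult mult_left_le\<close>)
  ultimately show ?thesis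
    using p(2) dvd_imp_le_int[of "\<Sum>i\<in>S. a i * e (u - scale (int p) (g i))" "int p"] by force
qed

text \<open>Induction over the prime factors of \<open>k\<close>: dilation moves the exponents only,
  so the bound on the primes stays the same throughout.\<close>

lemma dilate:
  fixes a :: "'i \<Rightarrow> int" and e :: "int \<times> int \<Rightarrow> int"
  assumes S: "finite S"
    and e: "\<And>u. \<bar>e u\<bar> \<le> 1" and ann: "\<And>u. (\<Sum>i\<in>S. a i * e (u - g i)) = 0"
    and k: "k > 0" "\<And>p. prime p \<Longrightarrow> p dvd k \<Longrightarrow> (\<Sum>i\<in>S. \<bar>a i\<bar>) < int p"
  shows "(\<Sum>i\<in>S. a i * e (u - scale (int k) (g i))) = 0"
  using k
proof (induction k arbitrary: u rule: less_induct)
  case (less k)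
  show ?case
  proof (cases "k = 1")
    case True
    then show ?thesis using ann by simp
  next
    case False
    then obtain p where p: "prime p" "p dvd k" using prime_factor_nat by blast
    then obtain l where l: "k = p * l" by (elim dvdE)
    have "l > 0" "l < k" using l less.prems(1) prime_gt_1_nat[OF p(1)] by auto
    then have "\<And>u. (\<Sum>i\<in>S. a i * e (u - scale (int l) (g i))) = 0"
      using less.IH less.prems(2) l by simp
    from dilate_prime[OF S p(1) _ e this] show ?thesis
      using less.prems(2)[OF p] by (simp add: scale_scale l)
  qed
qed

text \<open>
  Replacing the power sums \<open>s n\<close> by \<open>s (n + 1) - T k * s n\<close> multiplies the \<open>i\<close>-th coefficient by
  \<open>T i - T k\<close>, so all nodes but \<open>j\<close> can be eliminated one after the other.
\<close>

lemma vandermonde_ideal: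
  fixes y T :: "'i \<Rightarrow> 'r::comm_ring_1"
  assumes S: "finite S" "j \<in> S"
    and add: "\<And>x y. I x \<Longrightarrow> I y \<Longrightarrow> I (x - y)" and mult: "\<And>x y. I y \<Longrightarrow> I (x * y)"
    and sum: "\<And>n::nat. I (\<Sum>i\<in>S. y i * T i ^ n)"
  shows "I (y j * (\<Prod>i\<in>S - {j}. T j - T i))"
proof -
  \<comment> \<open>\<open>A\<close> is the set of nodes eliminated so far; the powers
    \<open>n\<close> must stay arbitrary, since each elimination uses \<open>n\<close> and
    \<open>Suc n\<close>.\<close>
  have *: "I (\<Sum>i\<in>S. y i * (\<Prod>k\<in>A. T i - T k) * T i ^ n)" if "finite A" for A n
    using that
  proof (induction A arbitrary: n)
    case empty
    then show ?case using sum by simp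
  next
    case (insert k A)
    have "I ((\<Sum>i\<in>S. y i * (\<Prod>k\<in>A. T i - T k) * T i ^ Suc n) -
        T k * (\<Sum>i\<in>S. y i * (\<Prod>k\<in>A. T i - T k) * T i ^ n))"
      by (intro add mult insert)
    also have "(\<Sum>i\<in>S. y i * (\<Prod>k\<in>A. T i - T k) * T i ^ Suc n) -
        T k * (\<Sum>i\<in>S. y i * (\<Prod>k\<in>A. T i - T k) * T i ^ n) =
        (\<Sum>i\<in>S. y i * (\<Prod>k\<in>insert k A. T i - T k) * T i ^ n)"
      unfolding sum_distrib_left sum_subtractf[symmetric] prod.insert[OF insert.hyps] power_Suc
      by (intro sum.cong refl) (simp only: algebra_simps)
    finally show ?case .
  qed
  \<comment> \<open>With all nodes but \<open>j\<close> eliminated, every summand other than the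
    \<open>j\<close>-th contains a zero factor.\<close>
  have "(\<Prod>k\<in>S - {j}. T i - T k) = 0" if "i \<in> S" "i \<noteq> j" for i
    using S that by (intro prod_zero) auto
  then have "(\<Sum>i\<in>S. y i * (\<Prod>k\<in>S - {j}. T i - T k) * T i ^ 0) =
      (\<Sum>i\<in>{j}. y i * (\<Prod>k\<in>S - {j}. T i - T k) * T i ^ 0)"
    using S by (intro sum.mono_neutral_right) auto
  then show ?thesis using *[of "S - {j}" 0] S by simp
qed

text \<open>Every \<open>k = 1 + n * r\<close> is free of the small primes that
  \<open>dilate\<close> excludes. These \<open>k\<close> form an arithmetic progression, so the
  dilated equations are power sums in the nodes \<open>X^(r v)\<close>, to which Vandermonde
  elimination applies.\<close>

lemma dilate_annihilator:
  fixes a :: "int \<times> int \<Rightarrow> int" and e :: "int \<times> int \<Rightarrow> int"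
  assumes S: "finite S" "w \<in> S" "a w \<noteq> 0"
    and e: "\<And>u. \<bar>e u\<bar> \<le> 1" and ann: "\<And>u. (\<Sum>v\<in>S. a v * e (u - v)) = 0"
    and r: "r = fact (nat (\<Sum>v\<in>S. \<bar>a v\<bar>))"
  shows "act (\<Prod>v\<in>S - {w}. Poly_Mapping.single (scale r w) 1 - Poly_Mapping.single (scale r v) 1)
           (\<lambda>u. complex_of_int (e u)) = (\<lambda>_. 0)"
proof -
  define E where "E = (\<lambda>u. complex_of_int (e u))"
  \<comment> \<open>\<open>I\<close> is the annihilator of \<open>E\<close>, an ideal of the group
    ring.\<close>
  define I where "I = (\<lambda>f. act f E = (\<lambda>_. 0))"
  define B where "B = nat (\<Sum>v\<in>S. \<bar>a v\<bar>)"
  define y where "y = (\<lambda>v. Poly_Mapping.single v (complex_of_int (a v)))"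
  define T where "T = (\<lambda>v. Poly_Mapping.single (scale r v) (1::complex))"
  have "I (\<Sum>v\<in>S. y v * T v ^ n)" for n
  proof -
    have "(\<Sum>v\<in>S. a v * e (u - scale (int (1 + n * fact B)) v)) = 0" for u
    proof (rule dilate[where S = S and a = a and e = e and g = "\<lambda>v. v", OF S(1) e ann])
      show "(\<Sum>i\<in>S. \<bar>a i\<bar>) < int p" if p: "prime p" "p dvd 1 + n * fact B" for p
      proof (rule ccontr)
        assume "\<not> ?thesis"
        \<comment> \<open>A prime that is at most \<open>B\<close> divides \<open>fact B\<close> and
          hence cannot divide \<open>1 + n * fact B\<close>.\<close>
        then have "p dvd fact B" using p(1) by (simp add: prime_dvd_fact_iff B_def)
        then have "p dvd 1" using p(2)
          using dvd_add_left_iff[of p "n * fact B" 1] by (meson dvd_mult)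
        then show False using p(1) by simp
      qed
    qed simp_all
    moreover have "scale (int (1 + n * fact B)) v = v + scale (int n) (scale r v)" for v
      by (simp add: r B_def scale_def prod_eq_iff algebra_simps)
    ultimately have eq: "(\<Sum>v\<in>S. a v * e (u - (v + scale (int n) (scale r v)))) = 0" for u
      by simp
    have "act (\<Sum>v\<in>S. y v * T v ^ n) E u = 0" for u
      using arg_cong[OF eq[of u], of complex_of_int]
      by (simp add: act_sum y_def T_def power_single mult_single E_def)
    then show ?thesis by (auto simp: I_def)
  qed
  moreover have "I (x - y)" if "I x" "I y" for x y
    using that by (simp add: I_def act_diff fun_eq_iff)
  moreover have "I (x * y)" if "I y" for x y
    using that by (simp add: I_def act_mult)
  ultimately have "I (y w * (\<Prod>v\<in>S - {w}. T w - T v))"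
    by (intro vandermonde_ideal[where I = I and S = S and j = w] S)
  \<comment> \<open>The remaining factor \<open>y w\<close> is a unit, since it is a monomial with
    coefficient \<open>a w \<noteq> 0\<close>; it is cancelled by its inverse.\<close>
  then have "I (Poly_Mapping.single (- w) (1 / complex_of_int (a w)) * (y w * (\<Prod>v\<in>S - {w}. T w - T v)))"
    by (simp add: I_def act_mult)
  then show ?thesis
    using S(3) by (simp add: I_def E_def T_def y_def mult_single flip: mult.assoc)
qed

text \<open>
  The joint kernel of \<open>f\<close> and \<open>g\<close> is finite-dimensional; this formulation avoids dimensions and is
  visibly stable under products of the \<open>g\<close>s.
\<close>

definition finitely_determined :: "('g::ab_group_add \<Rightarrow>\<^sub>0 complex) \<Rightarrow> ('g \<Rightarrow>\<^sub>0 complex) \<Rightarrow> bool" where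
  "finitely_determined f g \<longleftrightarrow>
     (\<exists>W. finite W \<and> (\<forall>h. act f h = (\<lambda>_. 0) \<longrightarrow> act g h = (\<lambda>_. 0) \<longrightarrow> (\<forall>u\<in>W. h u = 0) \<longrightarrow>
        h = (\<lambda>_. 0)))"

section \<open>Joint kernels determined by a finite window\<close>

text \<open>The window is enlarged so that zeros of \<open>h\<close> on it force zeros of
  \<open>act g2 h\<close> on the window for \<open>g1\<close>. Then \<open>act g2 h\<close>
  vanishes, being killed by \<open>f\<close> and \<open>g1\<close>, and after that \<open>h\<close>
  vanishes by the window for \<open>g2\<close>.\<close>

lemma finitely_determined_mult:
  assumes "finitely_determined f g1" "finitely_determined f g2"
  shows "finitely_determined f (g1 * g2)"
proof -
  from assms obtain W1 W2 where
    W1: "finite W1" "\<And>h. act f h = (\<lambda>_. 0) \<Longrightarrow> act g1 h = (\<lambda>_. 0) \<Longrightarrow> \<forall>u\<in>W1. h u = 0 \<Longrightarrow> h = (\<lambda>_. 0)" and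
    W2: "finite W2" "\<And>h. act f h = (\<lambda>_. 0) \<Longrightarrow> act g2 h = (\<lambda>_. 0) \<Longrightarrow> \<forall>u\<in>W2. h u = 0 \<Longrightarrow> h = (\<lambda>_. 0)"
    unfolding finitely_determined_def by metis
  let ?W = "(\<lambda>(u, v). u - v) ` (W1 \<times> Poly_Mapping.keys g2) \<union> W2"
  have "h = (\<lambda>_. 0)"
    if h: "act f h = (\<lambda>_. 0)" "act (g1 * g2) h = (\<lambda>_. 0)" "\<forall>u\<in>?W. h u = 0" for h
  proof -
    have "act g2 h u = 0" if "u \<in> W1" for u
      unfolding act_def using h(3) that by (intro sum.neutral) auto
    moreover have "act f (act g2 h) = (\<lambda>_. 0)"
      by (simp add: act_commute[of f] h)
    ultimately have "act g2 h = (\<lambda>_. 0)"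
      using W1(2)[of "act g2 h"] h(2) by (simp add: act_mult)
    then show ?thesis using W2(2) h by blast
  qed
  moreover have "finite ?W" using W1 W2 by simp
  ultimately show ?thesis unfolding finitely_determined_def by blast
qed

text \<open>A nonzero monomial is a unit, so its kernel is trivial and the empty window
  suffices.\<close>

lemma finitely_determined_single:
  assumes "a \<noteq> 0"
  shows "finitely_determined f (Poly_Mapping.single v a)"
proof -
  have "h = (\<lambda>_. 0)" if "act (Poly_Mapping.single v a) h = (\<lambda>_. 0)" for h
  proof
    fix u
    from fun_cong[OF that, of "u + v"] show "h u = 0" using assms by simp
  qed
  then show ?thesis unfolding finitely_determined_def by (intro exI[of _ "{}"]) blast
qed

lemma finitely_determined_prod:
  assumes "\<And>i. i \<in> A \<Longrightarrow> finitely_determined f (g i)"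
  shows "finitely_determined f (\<Prod>i\<in>A. g i)"
  using assms
proof (induction A rule: infinite_finite_induct)
  case (insert i A)
  then show ?case by (simp add: finitely_determined_mult)
qed (simp_all add: finitely_determined_single flip: single_one)

text \<open>Over the complex numbers \<open>p\<close> splits into linear factors, which reduces the
  claim to factors \<open>T - z\<close> and a nonzero constant.\<close>

lemma finitely_determined_poly:
  fixes T :: "'g::ab_group_add \<Rightarrow>\<^sub>0 complex"
  assumes lin: "\<And>z. finitely_determined f (T - Poly_Mapping.single 0 z)"
  shows "p \<noteq> 0 \<Longrightarrow> finitely_determined f (poly (map_poly (Poly_Mapping.single 0) p) T)"
proof (induction "degree p" arbitrary: p)
  case 0
  then obtain c where "p = [:c:]" "c \<noteq> 0" by (auto elim!: degree_eq_zeroE)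
  then show ?case by (simp add: map_poly_pCons finitely_determined_single)
next
  case (Suc n)
  then have "\<not> constant (poly p)" by (simp add: constant_degree)
  then obtain z where "poly p z = 0" using fundamental_theorem_of_algebra by blast
  then obtain q where q: "p = [:- z, 1:] * q" by (auto simp: poly_eq_0_iff_dvd elim: dvdE)
  with Suc have "q \<noteq> 0" by auto
  moreover from this have "degree p = degree [:- z, 1:] + degree q"
    unfolding q by (intro degree_mult_eq) simp_all
  ultimately have "q \<noteq> 0" "n = degree q" using Suc by simp_all
  then have IH: "finitely_determined f (poly (map_poly (Poly_Mapping.single 0) q) T)"
    using Suc by blast
  have "map_poly (Poly_Mapping.single 0) p =
      [:- Poly_Mapping.single 0 z, 1:] * map_poly (Poly_Mapping.single (0::'g)) q"
    by (rule poly_eqI)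
       (auto simp: q coeff_map_poly coeff_pCons single_diff single_add single_uminus mult_single split: nat.splits)
  then have "poly (map_poly (Poly_Mapping.single 0) p) T =
      (T - Poly_Mapping.single 0 z) * poly (map_poly (Poly_Mapping.single 0) q) T"
    by (simp only: poly_mult) (simp add: algebra_simps)
  then show ?case by (simp add: finitely_determined_mult lin IH)
qed

text \<open>The recurrence can be solved for its outermost terms with nonzero coefficient, hence
  continued in both directions from a window as long as the distance of the two.\<close>

lemma linear_recurrence_determined:
  fixes F :: "int \<Rightarrow> complex"
  assumes B: "finite B" "c \<in> B" "F c \<noteq> 0"
  shows "\<exists>L. \<forall>s. (\<forall>i. (\<Sum>b\<in>B. F b * s (i - b)) = 0) \<longrightarrow> (\<forall>i\<in>{0..<L}. s i = 0) \<longrightarrow> (\<forall>i. s i = 0)"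
proof -
  \<comment> \<open>Zero coefficients are dropped, so that the coefficients at the extreme indices
    \<open>m\<close> and \<open>M\<close> can be divided by.\<close>
  define A where "A = {b\<in>B. F b \<noteq> 0}"
  have A: "finite A" "A \<noteq> {}" using B by (auto simp: A_def)
  define m M where "m = Min A" and "M = Max A"
  have mM: "m \<in> A" "M \<in> A" "\<And>b. b \<in> A \<Longrightarrow> m \<le> b \<and> b \<le> M"
    using A by (auto simp: m_def M_def)
  have "s i = 0" if rec: "\<And>i. (\<Sum>b\<in>B. F b * s (i - b)) = 0" and 0: "\<And>i. i \<in> {0..<M - m} \<Longrightarrow> s i = 0"
    for s i
  proof -
    have recA: "(\<Sum>b\<in>A. F b * s (i - b)) = 0" for i
      using rec[of i] B(1) by (subst (asm) sum.mono_neutral_right[of B A]) (auto simp: A_def)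
    have extreme: "s (i - x) = 0" if "x \<in> A" "\<And>b. b \<in> A \<Longrightarrow> b \<noteq> x \<Longrightarrow> s (i - b) = 0" for i x
    proof -
      have "(\<Sum>b\<in>A. F b * s (i - b)) = (\<Sum>b\<in>{x}. F b * s (i - b))"
        using that A(1) by (intro sum.mono_neutral_right) auto
      then show ?thesis using recA[of i] that(1) by (simp add: A_def)
    qed
    \<comment> \<open>The interval of known zeros grows by one place on either side.\<close>
    have "\<forall>i. - int k \<le> i \<and> i < M - m + int k \<longrightarrow> s i = 0" for k
    proof (induction k)
      case (Suc k)
      have "s (M + int k - m) = 0"
      proof (rule extreme[OF mM(1)])
        fix b assume "b \<in> A" "b \<noteq> m"
        with mM(3)[of b] show "s (M + int k - b) = 0" by (intro Suc[rule_format]) auto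
      qed
      moreover have "s (M - int k - 1 - M) = 0"
      proof (rule extreme[OF mM(2)])
        fix b assume "b \<in> A" "b \<noteq> M"
        with mM(3)[of b] show "s (M - int k - 1 - b) = 0" by (intro Suc[rule_format]) auto
      qed
      moreover have "i = M + int k - m \<or> i = M - int k - 1 - M \<or> - int k \<le> i \<and> i < M - m + int k"
        if "- int (Suc k) \<le> i" "i < M - m + int (Suc k)" for i
        using that by auto
      ultimately show ?case using Suc by blast
    qed (use 0 in auto)
    from this[of "nat (\<bar>i\<bar> + \<bar>M - m\<bar> + 1)"] show ?thesis
      by (elim allE[of _ i] impE) auto
  qed
  then show ?thesis by (intro exI[of _ "M - m"]) blast
qed

lemma line_polynomial_binomial:
  assumes "w \<noteq> 0" "z \<noteq> 0"
  shows "line_polynomial (Poly_Mapping.single w 1 - Poly_Mapping.single 0 z)"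
proof -
  have "Poly_Mapping.keys (Poly_Mapping.single w 1 - Poly_Mapping.single 0 z :: laurent) = {0, w}"
    (is "?K = _")
  proof (rule set_eqI)
    fix x
    show "x \<in> ?K \<longleftrightarrow> x \<in> {0, w}"
      using assms by (cases "x = 0"; cases "x = w")
        (simp_all add: in_keys_iff lookup_minus lookup_single when_def)
  qed
  moreover have "0 \<in> rational_line 0 w" "w \<in> rational_line 0 w"
    by (auto simp: rational_line_def intro: exI[of _ 0] exI[of _ 1])
  ultimately have "Poly_Mapping.keys (Poly_Mapping.single w 1 - Poly_Mapping.single 0 z) \<subseteq> rational_line 0 w"
    "card (Poly_Mapping.keys (Poly_Mapping.single w 1 - Poly_Mapping.single 0 z :: laurent)) = 2"
    using assms by simp_all
  then show ?thesis unfolding line_polynomial_def by (metis order_refl)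
qed

text \<open>Modulo the divisor \<open>X^w\<close> equals \<open>z\<close>, hence
  \<open>X^(k w)\<close> equals \<open>z powi k\<close>. A negative exponent differs from its
  opposite by a unit factor only.\<close>

lemma binomial_dvd_single_minus_powi:
  fixes z :: complex
  assumes "z \<noteq> 0"
  shows "Poly_Mapping.single w 1 - Poly_Mapping.single 0 z dvd
    Poly_Mapping.single (scale k w) 1 - Poly_Mapping.single 0 (z powi k)"
proof -
  have nat: "Poly_Mapping.single w 1 - Poly_Mapping.single 0 z dvd
    Poly_Mapping.single (scale (int n) w) 1 - Poly_Mapping.single 0 (z ^ n)" for n
  proof -
    have "Poly_Mapping.single w 1 ^ n - Poly_Mapping.single 0 z ^ n =
      (Poly_Mapping.single w 1 - Poly_Mapping.single 0 z) *
      (\<Sum>i<n. Poly_Mapping.single 0 z ^ (n - Suc i) * Poly_Mapping.single w 1 ^ i)"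
      by (rule power_diff_sumr2)
    then show ?thesis by (simp add: power_single scale_def flip: zero_prod_def)
  qed
  show ?thesis
  proof (cases "k \<ge> 0")
    case True
    then show ?thesis using nat[of "nat k"] by (simp add: power_int_def)
  next
    case False
    define n where "n = nat (- k)"
    have k: "k = - int n" using False by (simp add: n_def)
    have "Poly_Mapping.single (scale k w) 1 - Poly_Mapping.single 0 (z powi k) =
      - Poly_Mapping.single (scale k w) (z powi k) *
      (Poly_Mapping.single (scale (int n) w) 1 - Poly_Mapping.single 0 (z ^ n))"
      using assms by (simp add: k right_diff_distrib mult_single power_int_minus scale_uminus)
    then show ?thesis using nat[of n] by simp
  qed
qed

text \<open>For nonzero \<open>z\<close>, substituting \<open>z\<close> for \<open>X^w\<close>
  leaves Laurent polynomials in one variable \<open>X^x\<close>, where \<open>x\<close> completes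
  \<open>w\<close> to a basis. The image of \<open>f\<close> is nonzero because
  \<open>X^w - z\<close> does not divide \<open>f\<close>, so it is a nontrivial recurrence for
  \<open>h\<close> on the multiples of \<open>x\<close>. All other values follow, since a shift by
  \<open>w\<close> multiplies \<open>h\<close> by \<open>z\<close>.\<close>

lemma finitely_determined_primitive:
  fixes f :: laurent
  assumes "coprime (fst w) (snd w)"
    and line: "\<not> (\<exists>h. line_polynomial h \<and> h dvd f)"
  shows "finitely_determined f (Poly_Mapping.single w 1 - Poly_Mapping.single 0 z)"
proof (cases "z = 0")
  case True
  then show ?thesis by (simp add: finitely_determined_single)
next
  case z: False
  obtain s r' where "s * fst w + r' * snd w = 1"
    using bezout_int[of "fst w" "snd w"] assms(1) by auto
  then obtain s r where bez: "fst w * s - snd w * r = 1"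
    by (metis diff_minus_eq_add mult.commute mult_minus_right)
  \<comment> \<open>By \<open>bez\<close> the vectors \<open>w\<close> and \<open>x\<close> form a
    basis of the lattice; \<open>\<alpha>\<close> and \<open>\<beta>\<close> are the coordinates
    along \<open>w\<close> and \<open>x\<close>.\<close>
  define x where "x = (r, s)"
  define \<alpha> where "\<alpha> = (\<lambda>v. fst v * s - snd v * r)"
  define \<beta> where "\<beta> = (\<lambda>v. fst w * snd v - snd w * fst v)"
  have decomp: "scale (\<beta> v) x + scale (\<alpha> v) w = v" for v
  proof -
    have "\<beta> v * r + \<alpha> v * fst w = fst v * (fst w * s - snd w * r)"
      "\<beta> v * s + \<alpha> v * snd w = snd v * (fst w * s - snd w * r)"
      by (simp_all add: \<alpha>_def \<beta>_def algebra_simps)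
    then show ?thesis by (simp add: prod_eq_iff bez x_def)
  qed
  \<comment> \<open>\<open>F b\<close> is the coefficient of \<open>X^(b x)\<close> after the
    substitution of \<open>z\<close> for \<open>X^w\<close> in \<open>f\<close>.\<close>
  define F where "F = (\<lambda>b. \<Sum>v | v \<in> Poly_Mapping.keys f \<and> \<beta> v = b. Poly_Mapping.lookup f v * z powi (\<alpha> v))"
  define B where "B = \<beta> ` Poly_Mapping.keys f"
  \<comment> \<open>If all these coefficients vanished, \<open>f\<close> would be divisible by the
    line polynomial \<open>X^w - z\<close>.\<close>
  have "\<exists>b\<in>B. F b \<noteq> 0"
  proof (rule ccontr)
    assume "\<not> ?thesis"
    then have F0: "F b = 0" if "b \<in> B" for b using that by blast
    let ?h = "Poly_Mapping.single w 1 - Poly_Mapping.single 0 z :: laurent"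
    let ?g = "\<lambda>v. Poly_Mapping.single (scale (\<beta> v) x) (Poly_Mapping.lookup f v * z powi (\<alpha> v))"
    have "Poly_Mapping.single v (Poly_Mapping.lookup f v) - ?g v =
        Poly_Mapping.single (scale (\<beta> v) x) (Poly_Mapping.lookup f v) *
        (Poly_Mapping.single (scale (\<alpha> v) w) 1 - Poly_Mapping.single 0 (z powi (\<alpha> v)))" for v
      by (simp add: right_diff_distrib mult_single decomp)
    then have "?h dvd Poly_Mapping.single v (Poly_Mapping.lookup f v) - ?g v" for v
      by (simp add: binomial_dvd_single_minus_powi z)
    then have "?h dvd (\<Sum>v\<in>Poly_Mapping.keys f. Poly_Mapping.single v (Poly_Mapping.lookup f v) - ?g v)"
      by (intro dvd_sum)
    moreover have "(\<Sum>v\<in>Poly_Mapping.keys f. ?g v) = 0"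
    proof -
      have "(\<Sum>v\<in>Poly_Mapping.keys f. ?g v) =
         (\<Sum>b\<in>B. \<Sum>v | v \<in> Poly_Mapping.keys f \<and> \<beta> v = b. ?g v)"
        unfolding B_def by (rule sum.image_gen) simp
      also have "\<dots> = (\<Sum>b\<in>B. Poly_Mapping.single (scale b x) (F b))"
        by (intro sum.cong refl poly_mapping_eqI)
           (simp add: F_def lookup_sum lookup_single when_def)
      finally show ?thesis by (simp add: F0)
    qed
    ultimately have "?h dvd f"
      by (simp add: sum_subtractf flip: poly_mapping_sum_single)
    moreover have "w \<noteq> 0" using assms(1) by auto
    ultimately show False using line line_polynomial_binomial[of w z] z by blast
  qed
  then obtain c where c: "c \<in> B" "F c \<noteq> 0" by blast
  have "finite B" by (simp add: B_def)
  from linear_recurrence_determined[of B c F, OF this c] obtain L where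
    L: "\<forall>s. (\<forall>i. (\<Sum>b\<in>B. F b * s (i - b)) = 0) \<longrightarrow> (\<forall>i\<in>{0..<L}. s i = 0) \<longrightarrow> (\<forall>i. s i = 0)"
    by (elim exE)
  have "h = (\<lambda>_. 0)" if h: "act f h = (\<lambda>_. 0)"
    "act (Poly_Mapping.single w 1 - Poly_Mapping.single 0 z) h = (\<lambda>_. 0)"
    "\<forall>u\<in>(\<lambda>i. scale i x) ` {0..<L}. h u = 0" for h
  proof -
    have step: "h (u - w) = z * h u" for u
      using fun_cong[OF h(2), of u] by (simp add: act_diff)
    have shift_nat: "h (u - scale (int n) w) = z ^ n * h u" for n u
    proof (induction n)
      case (Suc n)
      have "u - scale (int (Suc n)) w = (u - scale (int n) w) - w"
        by (simp add: prod_eq_iff algebra_simps)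
      then show ?case by (simp only: step Suc) simp
    qed simp
    have shift: "h (u - scale k w) = z powi k * h u" for k u
    proof (cases "k \<ge> 0")
      case True
      then show ?thesis using shift_nat[of u "nat k"] by (simp add: power_int_def)
    next
      case False
      define n where "n = nat (- k)"
      have k: "k = - int n" using False by (simp add: n_def)
      have *: "h u = z ^ n * h (u - scale k w)"
        using shift_nat[of "u - scale k w" n] by (simp add: k scale_uminus)
      have "z powi k * h u = inverse (z ^ n) * h u"
        by (simp add: k power_int_minus)
      also have "\<dots> = h (u - scale k w)"
        using z by (subst *) simp
      finally show ?thesis by (rule sym)
    qed
    \<comment> \<open>Grouping the summands of \<open>act f h\<close> by the value of
      \<open>\<beta>\<close> yields the recurrence with coefficients \<open>F\<close>.\<close>
    have zero: "h (scale i x) = 0" for i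
    proof (rule L[THEN spec, of "\<lambda>i. h (scale i x)", THEN mp, THEN mp, THEN spec]; (intro allI)?)
      fix i
      have "(\<Sum>b\<in>B. F b * h (scale (i - b) x)) =
         (\<Sum>b\<in>B. \<Sum>v | v \<in> Poly_Mapping.keys f \<and> \<beta> v = b. Poly_Mapping.lookup f v * h (scale i x - v))"
      proof (rule sum.cong[OF refl])
        fix b
        have "h (scale i x - v) = z powi (\<alpha> v) * h (scale (i - \<beta> v) x)" for v
        proof -
          have "scale i x - v = scale (i - \<beta> v) x - scale (\<alpha> v) w"
            using arg_cong[OF decomp[of v], of "\<lambda>y. scale i x - y"]
            by (simp add: scale_diff diff_diff_eq)
          then show ?thesis by (simp add: shift)
        qed
        then show "F b * h (scale (i - b) x) =
          (\<Sum>v | v \<in> Poly_Mapping.keys f \<and> \<beta> v = b. Poly_Mapping.lookup f v * h (scale i x - v))"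
          unfolding F_def sum_distrib_right by (intro sum.cong) auto
      qed
      also have "\<dots> = act f h (scale i x)"
        unfolding B_def act_def by (rule sum.image_gen[symmetric]) simp
      finally show "(\<Sum>b\<in>B. F b * h (scale (i - b) x)) = 0" by (simp add: h(1))
    qed (use h(3) in auto)
    have "h u = 0" for u
      using shift[of "scale (\<beta> u) x" "- \<alpha> u"] by (simp add: scale_uminus decomp zero)
    then show ?thesis by (rule ext)
  qed
  then show ?thesis unfolding finitely_determined_def
    by (intro exI[of _ "(\<lambda>i. scale i x) ` {0..<L}"]) auto
qed

text \<open>Write \<open>v - w = d x\<close> with \<open>x\<close> primitive. Up to the unit
  \<open>X^w\<close> the binomial is \<open>T^d - 1\<close> with \<open>T = X^x\<close>, a
  one-variable polynomial whose linear factors fall under the primitive case.\<close>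

lemma finitely_determined_binomial:
  fixes f :: laurent
  assumes "v \<noteq> w" and line: "\<not> (\<exists>h. line_polynomial h \<and> h dvd f)"
  shows "finitely_determined f (Poly_Mapping.single v 1 - Poly_Mapping.single w 1)"
proof -
  define d where "d = gcd (fst (v - w)) (snd (v - w))"
  have d: "d > 0" using assms(1) by (auto simp: d_def prod_eq_iff gcd_pos_int)
  define x where "x = (fst (v - w) div d, snd (v - w) div d)"
  have cop: "coprime (fst x) (snd x)"
    using div_gcd_coprime[of "fst (v - w)" "snd (v - w)"] assms(1)
    by (simp add: x_def d_def prod_eq_iff)
  have x: "scale d x = v - w"
    by (simp add: prod_eq_iff x_def d_def)
  define T where "T = (Poly_Mapping.single x 1 :: laurent)"
  let ?p = "monom 1 (nat d) - 1 :: complex poly"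
  have "coeff ?p (nat d) = 1" using d by simp
  then have "?p \<noteq> 0" by (metis coeff_0 zero_neq_one)
  from finitely_determined_poly[OF _ this, of f T]
  have "finitely_determined f (poly (map_poly (Poly_Mapping.single 0) ?p) T)"
    using finitely_determined_primitive[OF cop line] by (simp add: T_def)
  also have "map_poly (Poly_Mapping.single (0::int\<times>int)) ?p = monom 1 (nat d) - 1"
    by (rule poly_eqI) (simp add: coeff_map_poly single_diff)
  also have "poly (monom 1 (nat d) - 1) T = Poly_Mapping.single (v - w) 1 - 1"
    using d by (simp add: poly_monom T_def power_single x)
  finally have "finitely_determined f (Poly_Mapping.single w 1 * (Poly_Mapping.single (v - w) 1 - 1))"
    by (intro finitely_determined_mult finitely_determined_single) simp_all
  then show ?thesis by (simp add: right_diff_distrib mult_single)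
qed

text \<open>The window for \<open>f\<close> and the product \<open>g\<close> depends on the
  coefficients \<open>a\<close> alone, so restriction to it embeds the solutions into a finite set
  of functions with values in \<open>{-1..1}\<close>.\<close>

theorem finite_bounded_annihilated:
  fixes a :: "int \<times> int \<Rightarrow> int"
  assumes S: "finite S"
    and line: "\<not> (\<exists>h. line_polynomial h \<and> h dvd (\<Sum>v\<in>S. Poly_Mapping.single v (complex_of_int (a v))))"
  shows "finite {e. (\<forall>u. \<bar>e u\<bar> \<le> 1) \<and> (\<forall>u. (\<Sum>v\<in>S. a v * e (u - v)) = 0)}" (is "finite ?K")
proof -
  define f where "f = (\<Sum>v\<in>S. Poly_Mapping.single v (complex_of_int (a v)))"
  \<comment> \<open>The zero polynomial is divisible by every line polynomial, for instance by
    \<open>X^(1, 0) - 1\<close>.\<close>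
  have "\<exists>w\<in>S. a w \<noteq> 0"
  proof (rule ccontr)
    assume "\<not> ?thesis"
    then have "f = 0" by (simp add: f_def)
    then show False using line line_polynomial_binomial[of "(1, 0)" 1]
      by (auto simp: f_def zero_prod_def)
  qed
  then obtain w where w: "w \<in> S" "a w \<noteq> 0" by blast
  define r :: int where "r = fact (nat (\<Sum>v\<in>S. \<bar>a v\<bar>))"
  define g :: laurent where "g = (\<Prod>v\<in>S - {w}. Poly_Mapping.single (scale r w) 1 - Poly_Mapping.single (scale r v) 1)"
  have r: "r \<noteq> 0" by (simp add: r_def)
  have "finitely_determined f g"
    unfolding g_def
  proof (rule finitely_determined_prod)
    fix v assume "v \<in> S - {w}"
    then have "scale r w \<noteq> scale r v" using r by (auto simp: prod_eq_iff)
    then show "finitely_determined f (Poly_Mapping.single (scale r w) 1 - Poly_Mapping.single (scale r v) 1)"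
      using line by (intro finitely_determined_binomial) (simp_all add: f_def)
  qed
  then obtain W where W: "finite W"
    "\<And>h. act f h = (\<lambda>_. 0) \<Longrightarrow> act g h = (\<lambda>_. 0) \<Longrightarrow> \<forall>u\<in>W. h u = 0 \<Longrightarrow> h = (\<lambda>_. 0)"
    unfolding finitely_determined_def by blast
  have fe: "act f (\<lambda>u. complex_of_int (e u)) = (\<lambda>_. 0)" if "e \<in> ?K" for e
  proof
    fix u
    have "(\<Sum>v\<in>S. a v * e (u - v)) = 0" using that by blast
    from arg_cong[OF this, of complex_of_int]
    show "act f (\<lambda>u. complex_of_int (e u)) u = 0" by (simp add: f_def act_sum)
  qed
  have ge: "act g (\<lambda>u. complex_of_int (e u)) = (\<lambda>_. 0)" if "e \<in> ?K" for e
    unfolding g_def by (rule dilate_annihilator) (use S w that in \<open>auto simp: r_def\<close>)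
  have inj: "inj_on (\<lambda>e. restrict e W) ?K"
  proof (rule inj_onI)
    fix e e' assume e: "e \<in> ?K" "e' \<in> ?K" and eq: "restrict e W = restrict e' W"
    \<comment> \<open>The difference may leave the range \<open>{-1..1}\<close>, but by linearity
      \<open>f\<close> and \<open>g\<close> still annihilate it.\<close>
    have "(\<lambda>u. complex_of_int (e u) - complex_of_int (e' u)) = (\<lambda>_. 0)"
    proof (rule W(2))
      show "\<forall>u\<in>W. complex_of_int (e u) - complex_of_int (e' u) = 0"
        using eq by (metis diff_self restrict_apply')
    qed (use fe[OF e(1)] fe[OF e(2)] ge[OF e(1)] ge[OF e(2)] in \<open>simp_all add: act_fun_diff fun_eq_iff\<close>)
    then show "e = e'" by (simp add: fun_eq_iff)
  qed
  have "(\<lambda>e. restrict e W) ` ?K \<subseteq> W \<rightarrow>\<^sub>E {-1..1}"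
    by (auto simp: abs_le_iff)
  then have "finite ((\<lambda>e. restrict e W) ` ?K)"
    by (rule finite_subset) (simp add: finite_PiE W(1))
  then show ?thesis using inj by (rule finite_imageD)
qed

section \<open>A calculus of computable functions\<close>

text \<open>
  Arguments are passed as an environment \<open>\<rho>\<close>, so that the variable bound by a sum or a bounded
  quantifier becomes \<open>\<rho> 0\<close> and the outer environment \<open>\<lambda>n. \<rho> (Suc n)\<close>; the closure rules can then be
  applied by unification. Environments beyond the arity \<open>k\<close> are unspecified values of \<open>(!)\<close>.
\<close>

definition computable :: "nat \<Rightarrow> ((nat \<Rightarrow> nat) \<Rightarrow> nat) \<Rightarrow> bool" where
  "computable k f \<longleftrightarrow> (\<exists>r. \<forall>xs. length xs = k \<longrightarrow> computes r xs (f (nth xs)))"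

lemma computable_const: "computable k (\<lambda>\<rho>. c)"
proof -
  have "\<exists>r. \<forall>xs. length xs = k \<longrightarrow> computes r xs c"
  proof (induction c)
    case 0
    show ?case by (intro exI[of _ Zero]) (simp add: computes.Zero)
  next
    case (Suc c)
    then obtain r where "\<forall>xs. length xs = k \<longrightarrow> computes r xs c" ..
    then show ?case
      by (intro exI[of _ "Comp Succ [r]"]) (auto intro!: computes.Comp[of _ _ "[c]"] computes.Succ)
  qed
  then show ?thesis by (simp add: computable_def)
qed

lemma computes_Proj_eq: "i < length xs \<Longrightarrow> y = xs ! i \<Longrightarrow> computes (Proj i) xs y"
  by (simp add: computes.Proj)

lemma computable_var: "n < k \<Longrightarrow> computable k (\<lambda>\<rho>. \<rho> n)"
  unfolding computable_def by (intro exI[of _ "Proj n"]) (simp add: computes.Proj)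

lemma computable_comp:
  assumes f: "computable (length gs) f" and gs: "\<And>g. g \<in> set gs \<Longrightarrow> computable k g"
  shows "computable k (\<lambda>\<rho>. f (nth (map (\<lambda>g. g \<rho>) gs)))"
proof -
  from f obtain r where r: "\<And>xs. length xs = length gs \<Longrightarrow> computes r xs (f (nth xs))"
    unfolding computable_def by blast
  have "\<forall>g\<in>set gs. \<exists>r. \<forall>xs. length xs = k \<longrightarrow> computes r xs (g (nth xs))"
    using gs unfolding computable_def by blast
  then obtain s where s: "\<And>g xs. g \<in> set gs \<Longrightarrow> length xs = k \<Longrightarrow> computes (s g) xs (g (nth xs))"
    by metis
  have "computes (Comp r (map s gs)) xs (f (nth (map (\<lambda>g. g (nth xs)) gs)))" if "length xs = k" for xs
    by (rule computes.Comp[where ys = "map (\<lambda>g. g (nth xs)) gs"])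
       (use that s r in \<open>auto simp: list_all2_conv_all_nth\<close>)
  then show ?thesis unfolding computable_def by blast
qed

lemma computable_comp1:
  assumes "computable (Suc 0) (\<lambda>\<rho>. h (\<rho> 0))" "computable k f"
  shows "computable k (\<lambda>\<rho>. h (f \<rho>))"
  using computable_comp[of "[f]" "\<lambda>\<rho>. h (\<rho> 0)" k] assms by simp

lemma computable_comp2:
  assumes "computable (Suc (Suc 0)) (\<lambda>\<rho>. h (\<rho> 0) (\<rho> (Suc 0)))" "computable k f" "computable k g"
  shows "computable k (\<lambda>\<rho>. h (f \<rho>) (g \<rho>))"
  using computable_comp[of "[f, g]" "\<lambda>\<rho>. h (\<rho> 0) (\<rho> (Suc 0))" k] assms by auto

lemma computable_rec_nat:
  assumes "computable k b" "computable (Suc (Suc k)) (\<lambda>\<rho>. s (\<rho> 0) (\<rho> (Suc 0)) (\<lambda>n. \<rho> (Suc (Suc n))))"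
    "computable k f"
  shows "computable k (\<lambda>\<rho>. rec_nat (b \<rho>) (\<lambda>i y. s i y \<rho>) (f \<rho>))"
proof -
  from assms obtain rb rs rf where
    rb: "\<And>xs. length xs = k \<Longrightarrow> computes rb xs (b (nth xs))" and
    rs: "\<And>xs. length xs = Suc (Suc k) \<Longrightarrow> computes rs xs (s (xs ! 0) (xs ! Suc 0) (\<lambda>n. xs ! Suc (Suc n)))" and
    rf: "\<And>xs. length xs = k \<Longrightarrow> computes rf xs (f (nth xs))"
    unfolding computable_def by blast
  have rec: "computes (PrimRec rb rs) (n # xs) (rec_nat (b (nth xs)) (\<lambda>i y. s i y (nth xs)) n)"
    if "length xs = k" for xs n
  proof (induction n)
    case 0
    show ?case using rb that by (simp add: computes.PrimRec_0)
  next
    case (Suc n)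
    let ?y = "rec_nat (b (nth xs)) (\<lambda>i y. s i y (nth xs)) n"
    have "computes rs (n # ?y # xs) (s n ?y (nth xs))"
      using rs[of "n # ?y # xs"] that by simp
    with Suc show ?case by (auto intro: computes.PrimRec_Suc)
  qed
  \<comment> \<open>The projections hand the whole environment on as the parameters of the
    recursion.\<close>
  have "computes (Comp (PrimRec rb rs) (rf # map Proj [0..<k])) xs
      (rec_nat (b (nth xs)) (\<lambda>i y. s i y (nth xs)) (f (nth xs)))" if "length xs = k" for xs
    by (rule computes.Comp[where ys = "f (nth xs) # xs"])
       (use that rf rec in \<open>auto simp: list_all2_conv_all_nth nth_Cons' intro!: computes_Proj_eq\<close>)
  then show ?thesis unfolding computable_def by blast
qed

lemma computable_Suc:
  assumes "computable k f"
  shows "computable k (\<lambda>\<rho>. Suc (f \<rho>))"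
proof (rule computable_comp1[OF _ assms])
  show "computable (Suc 0) (\<lambda>\<rho>. Suc (\<rho> 0))"
    unfolding computable_def
    by (intro exI[of _ Succ]) (auto simp: length_Suc_conv intro: computes.Succ)
qed

lemma computable_add:
  assumes "computable k f" "computable k g"
  shows "computable k (\<lambda>\<rho>. f \<rho> + g \<rho>)"
proof (rule computable_comp2[OF _ assms])
  have "computable (Suc (Suc 0)) (\<lambda>\<rho>. rec_nat (\<rho> (Suc 0)) (\<lambda>i y. Suc y) (\<rho> 0))"
    by (rule computable_rec_nat) (intro computable_Suc computable_var; simp)+
  also have "(\<lambda>\<rho>. rec_nat (\<rho> (Suc 0)) (\<lambda>i y. Suc y) (\<rho> 0)) = (\<lambda>\<rho>. \<rho> 0 + \<rho> (Suc 0))"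
  proof
    fix \<rho> :: "nat \<Rightarrow> nat"
    have "rec_nat m (\<lambda>i y. Suc y) n = n + m" for m n :: nat
      by (induction n) simp_all
    then show "rec_nat (\<rho> (Suc 0)) (\<lambda>i y. Suc y) (\<rho> 0) = \<rho> 0 + \<rho> (Suc 0)" .
  qed
  finally show "computable (Suc (Suc 0)) (\<lambda>\<rho>. \<rho> 0 + \<rho> (Suc 0))" .
qed

lemma rec_nat_sum: "rec_nat 0 (\<lambda>i y. y + f i) n = (\<Sum>i<n. f i :: nat)"
  by (induction n) simp_all

lemma computable_sum:
  assumes f: "computable (Suc k) (\<lambda>\<rho>. f (\<rho> 0) (\<lambda>n. \<rho> (Suc n)))" and g: "computable k g"
  shows "computable k (\<lambda>\<rho>. \<Sum>i<g \<rho>. f i \<rho>)"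
proof -
  \<comment> \<open>The recursion step receives the accumulator as an additional argument in
    position 1; the program for \<open>f\<close> is composed with projections that skip it.\<close>
  have "computable (Suc (Suc k)) (\<lambda>\<rho>. f (\<rho> 0) (\<lambda>n. \<rho> (Suc (Suc n))))"
  proof -
    from f obtain r where r: "\<And>xs. length xs = Suc k \<Longrightarrow> computes r xs (f (xs ! 0) (\<lambda>n. xs ! Suc n))"
      unfolding computable_def by blast
    have "computes (Comp r (map Proj (0 # [2..<Suc (Suc k)]))) xs (f (xs ! 0) (\<lambda>n. xs ! Suc (Suc n)))"
      if "length xs = Suc (Suc k)" for xs
    proof -
      from that obtain i y zs where xs: "xs = i # y # zs" "length zs = k"
        by (auto simp: length_Suc_conv)
      show ?thesis
        by (rule computes.Comp[where ys = "i # zs"])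
           (use r[of "i # zs"] xs in \<open>auto simp: list_all2_conv_all_nth nth_Cons' intro!: computes_Proj_eq
              simp del: upt_Suc\<close>)
    qed
    then show ?thesis unfolding computable_def by blast
  qed
  then have "computable k (\<lambda>\<rho>. rec_nat 0 (\<lambda>i y. y + f i \<rho>) (g \<rho>))"
    by (intro computable_rec_nat computable_const g computable_add computable_var) simp_all
  then show ?thesis by (simp only: rec_nat_sum)
qed

lemma computable_mult:
  assumes "computable k f" "computable k g"
  shows "computable k (\<lambda>\<rho>. f \<rho> * g \<rho>)"
proof (rule computable_comp2[OF _ assms])
  have "computable (Suc (Suc 0)) (\<lambda>\<rho>. \<Sum>i<\<rho> 0. \<rho> (Suc 0))"
    by (intro computable_sum computable_var) simp_all
  then show "computable (Suc (Suc 0)) (\<lambda>\<rho>. \<rho> 0 * \<rho> (Suc 0))" by simp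
qed

lemma computable_pred:
  assumes "computable k f"
  shows "computable k (\<lambda>\<rho>. f \<rho> - 1)"
proof -
  have "computable k (\<lambda>\<rho>. rec_nat 0 (\<lambda>i y. i) (f \<rho>))"
    by (intro computable_rec_nat computable_const assms computable_var) simp
  moreover have "rec_nat 0 (\<lambda>i y. i) n = n - 1" for n :: nat
    by (cases n) simp_all
  ultimately show ?thesis by simp
qed

lemma computable_diff:
  assumes "computable k f" "computable k g"
  shows "computable k (\<lambda>\<rho>. f \<rho> - g \<rho>)"
proof -
  have "computable k (\<lambda>\<rho>. rec_nat (f \<rho>) (\<lambda>i y. y - 1) (g \<rho>))"
    by (intro computable_rec_nat computable_pred assms computable_var) simp
  moreover have "rec_nat m (\<lambda>i y. y - 1) n = m - n" for m n :: nat
    by (induction n) simp_all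
  ultimately show ?thesis by simp
qed

lemma computable_power:
  assumes "computable k f" "computable k g"
  shows "computable k (\<lambda>\<rho>. f \<rho> ^ g \<rho>)"
proof (rule computable_comp2[OF _ assms])
  have "computable (Suc (Suc 0)) (\<lambda>\<rho>. rec_nat 1 (\<lambda>i y. \<rho> 0 * y) (\<rho> (Suc 0)))"
    by (intro computable_rec_nat computable_mult computable_const computable_var) simp_all
  moreover have "rec_nat 1 (\<lambda>i y. m * y) n = m ^ n" for m n :: nat
    by (induction n) simp_all
  ultimately show "computable (Suc (Suc 0)) (\<lambda>\<rho>. \<rho> 0 ^ \<rho> (Suc 0))" by simp
qed

abbreviation decidable :: "nat \<Rightarrow> ((nat \<Rightarrow> nat) \<Rightarrow> bool) \<Rightarrow> bool" where
  "decidable k P \<equiv> computable k (\<lambda>\<rho>. of_bool (P \<rho>))"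

lemma decidable_not:
  assumes "decidable k P"
  shows "decidable k (\<lambda>\<rho>. \<not> P \<rho>)"
proof -
  have "computable k (\<lambda>\<rho>. 1 - of_bool (P \<rho>))"
    by (intro computable_diff computable_const assms)
  moreover have "1 - of_bool p = (of_bool (\<not> p) :: nat)" for p
    by simp
  ultimately show ?thesis by (simp only:)
qed

lemma decidable_conj: "decidable k P \<Longrightarrow> decidable k Q \<Longrightarrow> decidable k (\<lambda>\<rho>. P \<rho> \<and> Q \<rho>)"
  by (simp only: of_bool_conj computable_mult)

lemma decidable_imp:
  assumes "decidable k P" "decidable k Q"
  shows "decidable k (\<lambda>\<rho>. P \<rho> \<longrightarrow> Q \<rho>)"
  using decidable_not[OF decidable_conj[OF assms(1) decidable_not[OF assms(2)]]] by simp

lemma decidable_le: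
  assumes "computable k f" "computable k g"
  shows "decidable k (\<lambda>\<rho>. f \<rho> \<le> g \<rho>)"
proof -
  have "computable k (\<lambda>\<rho>. 1 - (f \<rho> - g \<rho>))"
    by (intro computable_diff computable_const assms)
  moreover have "1 - (m - n) = of_bool (m \<le> n)" for m n :: nat
    by auto
  ultimately show ?thesis by simp
qed

lemma decidable_less:
  assumes "computable k f" "computable k g"
  shows "decidable k (\<lambda>\<rho>. f \<rho> < g \<rho>)"
  using decidable_not[OF decidable_le[OF assms(2,1)]] by (simp add: not_le)

lemma decidable_eq:
  assumes "computable k f" "computable k g"
  shows "decidable k (\<lambda>\<rho>. f \<rho> = g \<rho>)"
  using decidable_conj[OF decidable_le[OF assms] decidable_le[OF assms(2,1)]]
  by (simp add: order_eq_iff)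

lemma decidable_iff:
  assumes "decidable k P" "decidable k Q"
  shows "decidable k (\<lambda>\<rho>. P \<rho> \<longleftrightarrow> Q \<rho>)"
  using decidable_eq[OF assms] by (simp only: of_bool_eq_iff)

lemma decidable_ex:
  assumes "decidable (Suc k) (\<lambda>\<rho>. P (\<rho> 0) (\<lambda>n. \<rho> (Suc n)))" "computable k g"
  shows "decidable k (\<lambda>\<rho>. \<exists>i<g \<rho>. P i \<rho>)"
proof -
  have "computable k (\<lambda>\<rho>. \<Sum>i<g \<rho>. of_bool (P i \<rho>))"
    by (rule computable_sum[where f = "\<lambda>i \<rho>. of_bool (P i \<rho>)", OF assms])
  then have "decidable k (\<lambda>\<rho>. 0 < (\<Sum>i<g \<rho>. of_bool (P i \<rho>) :: nat))"
    by (rule decidable_less[OF computable_const])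
  moreover have "0 < (\<Sum>i<g \<rho>. of_bool (P i \<rho>) :: nat) \<longleftrightarrow> (\<exists>i<g \<rho>. P i \<rho>)" for \<rho>
    by (auto simp: sum_eq_0_iff neq0_conv[symmetric] simp del: neq0_conv)
  ultimately show ?thesis by simp
qed

lemma decidable_all:
  assumes "decidable (Suc k) (\<lambda>\<rho>. P (\<rho> 0) (\<lambda>n. \<rho> (Suc n)))" "computable k g"
  shows "decidable k (\<lambda>\<rho>. \<forall>i<g \<rho>. P i \<rho>)"
  using decidable_not[OF decidable_ex[of k "\<lambda>i \<rho>. \<not> P i \<rho>", OF decidable_not[OF assms(1)] assms(2)]]
  by simp

lemma computable_if:
  assumes "decidable k P" "computable k f" "computable k g"
  shows "computable k (\<lambda>\<rho>. if P \<rho> then f \<rho> else g \<rho>)"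
proof -
  have "computable k (\<lambda>\<rho>. of_bool (P \<rho>) * f \<rho> + of_bool (\<not> P \<rho>) * g \<rho>)"
    by (intro computable_add computable_mult decidable_not assms)
  moreover have "of_bool (P \<rho>) * f \<rho> + of_bool (\<not> P \<rho>) * g \<rho> = (if P \<rho> then f \<rho> else g \<rho>)" for \<rho>
    by simp
  ultimately show ?thesis by simp
qed

lemmas computable_intros =
  computable_Suc computable_add computable_mult computable_diff computable_power computable_sum
  computable_if decidable_not decidable_conj decidable_imp decidable_le decidable_less decidable_eq
  decidable_iff decidable_ex decidable_all computable_const computable_var

section \<open>Computability of arithmetic and of the codings\<close>

lemma computable_div:
  assumes "computable k f" "computable k g"
  shows "computable k (\<lambda>\<rho>. f \<rho> div g \<rho>)"
proof (rule computable_comp2[OF _ assms])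
  \<comment> \<open>The quotient counts the positive multiples of \<open>n\<close> up to
    \<open>m\<close>; the case \<open>n = 0\<close> follows the convention for division by
    zero.\<close>
  have "m div n = (if n = 0 then 0 else \<Sum>i<m. of_bool (Suc i * n \<le> m))" for m n :: nat
  proof (cases "n = 0")
    case False
    have "{i. i < m \<and> Suc i * n \<le> m} = {..<m div n}"
    proof (intro set_eqI)
      fix i
      have "Suc i * n \<le> m \<longleftrightarrow> Suc i \<le> m div n"
        using less_eq_div_iff_mult_less_eq[of n "Suc i" m] False by blast
      moreover have "m div n \<le> m" by (rule div_le_dividend)
      ultimately show "i \<in> {i. i < m \<and> Suc i * n \<le> m} \<longleftrightarrow> i \<in> {..<m div n}"
        unfolding mem_Collect_eq lessThan_iff by linarith
    qed
    moreover have "(\<Sum>i<m. of_bool (Suc i * n \<le> m)) = card {i. i < m \<and> Suc i * n \<le> m}"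
      by (simp add: of_bool_def sum.If_cases Int_def del: mult_Suc)
    ultimately show ?thesis using False by simp
  qed simp
  moreover have "computable (Suc (Suc 0)) (\<lambda>\<rho>. if \<rho> (Suc 0) = 0 then 0 else
      \<Sum>i<\<rho> 0. of_bool (Suc i * \<rho> (Suc 0) \<le> \<rho> 0))"
    by (intro computable_intros; simp)
  ultimately show "computable (Suc (Suc 0)) (\<lambda>\<rho>. \<rho> 0 div \<rho> (Suc 0))" by simp
qed

lemma computable_mod:
  assumes "computable k f" "computable k g"
  shows "computable k (\<lambda>\<rho>. f \<rho> mod g \<rho>)"
  by (simp only: minus_div_mult_eq_mod[symmetric])
     (intro computable_diff computable_mult computable_div assms)

lemma decidable_odd:
  assumes "computable k f"
  shows "decidable k (\<lambda>\<rho>. odd (f \<rho>))"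
  unfolding odd_iff_mod_2_eq_one by (intro decidable_eq computable_mod computable_const assms)

lemma computable_prod_encode:
  assumes "computable k f" "computable k g"
  shows "computable k (\<lambda>\<rho>. prod_encode (f \<rho>, g \<rho>))"
proof -
  have "computable k (\<lambda>\<rho>. (f \<rho> + g \<rho>) * Suc (f \<rho> + g \<rho>) div 2 + f \<rho>)"
    by (intro computable_intros computable_div assms)
  then show ?thesis by (simp add: prod_encode_def triangle_def)
qed

lemma computable_fst_prod_decode:
  assumes "computable k f"
  shows "computable k (\<lambda>\<rho>. fst (prod_decode (f \<rho>)))"
proof (rule computable_comp1[OF _ assms])
  \<comment> \<open>Both components of a pair are bounded by its code, so a bounded search suffices;
    only the true component contributes to the sum.\<close>
  have "fst (prod_decode n) =
      (\<Sum>x<Suc n. x * of_bool (\<exists>y<Suc n. prod_encode (x, y) = n))" for n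
  proof -
    obtain u v where n: "n = prod_encode (u, v)"
      by (metis prod_decode_inverse surj_pair)
    have "(\<Sum>x<Suc n. x * of_bool (\<exists>y<Suc n. prod_encode (x, y) = n)) =
        (\<Sum>x\<in>{u}. x * of_bool (\<exists>y<Suc n. prod_encode (x, y) = n))"
      using le_prod_encode_1[of u v]
      by (intro sum.mono_neutral_right) (auto simp: n less_Suc_eq_le)
    also have "\<dots> = u"
      using le_prod_encode_2[of v u] by (auto simp: n less_Suc_eq_le)
    finally show ?thesis by (simp add: n)
  qed
  moreover have "computable (Suc 0) (\<lambda>\<rho>. \<Sum>x<Suc (\<rho> 0).
      x * of_bool (\<exists>y<Suc (\<rho> 0). prod_encode (x, y) = \<rho> 0))"
    by (intro computable_intros computable_prod_encode; simp)
  ultimately show "computable (Suc 0) (\<lambda>\<rho>. fst (prod_decode (\<rho> 0)))" by simp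
qed

lemma computable_snd_prod_decode:
  assumes "computable k f"
  shows "computable k (\<lambda>\<rho>. snd (prod_decode (f \<rho>)))"
proof (rule computable_comp1[OF _ assms])
  have "snd (prod_decode n) =
      (\<Sum>y<Suc n. y * of_bool (\<exists>x<Suc n. prod_encode (x, y) = n))" for n
  proof -
    obtain u v where n: "n = prod_encode (u, v)"
      by (metis prod_decode_inverse surj_pair)
    have "(\<Sum>y<Suc n. y * of_bool (\<exists>x<Suc n. prod_encode (x, y) = n)) =
        (\<Sum>y\<in>{v}. y * of_bool (\<exists>x<Suc n. prod_encode (x, y) = n))"
      using le_prod_encode_2[of v u]
      by (intro sum.mono_neutral_right) (auto simp: n less_Suc_eq_le)
    also have "\<dots> = v"
      using le_prod_encode_1[of u v] by (auto simp: n less_Suc_eq_le)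
    finally show ?thesis by (simp add: n)
  qed
  moreover have "computable (Suc 0) (\<lambda>\<rho>. \<Sum>y<Suc (\<rho> 0).
      y * of_bool (\<exists>x<Suc (\<rho> 0). prod_encode (x, y) = \<rho> 0))"
    by (intro computable_intros computable_prod_encode; simp)
  ultimately show "computable (Suc 0) (\<lambda>\<rho>. snd (prod_decode (\<rho> 0)))" by simp
qed

text \<open>A nonempty list is coded as the successor of the code of its head and tail; the
  subtraction removes that successor.\<close>

definition list_code_tl :: "nat \<Rightarrow> nat" where
  "list_code_tl n = snd (prod_decode (n - 1))"

lemma list_code_tl_funpow: "(list_code_tl ^^ i) (list_encode xs) = list_encode (drop i xs)"
proof (induction i)
  case (Suc i)
  show ?case
  proof (cases "i < length xs")
    case True
    have "(list_code_tl ^^ Suc i) (list_encode xs) = list_code_tl (list_encode (drop i xs))"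
      by (simp add: Suc)
    also have "\<dots> = list_encode (drop (Suc i) xs)"
      by (subst Cons_nth_drop_Suc[OF True, symmetric]) (simp add: list_code_tl_def)
    finally show ?thesis .
  next
    case False
    \<comment> \<open>The code 0 of the empty list is therefore mapped to itself, so iterating past
      the end is harmless.\<close>
    have "prod_decode 0 = (0, 0)"
      using prod_encode_inverse[of "(0, 0)"] by (simp add: prod_encode_def)
    with False Suc show ?thesis by (simp add: list_code_tl_def)
  qed
qed simp

lemma length_le_list_encode: "length xs \<le> list_encode xs"
proof (induction xs)
  case (Cons x xs)
  then show ?case using le_prod_encode_2[of "list_encode xs" x] by simp
qed simp

text \<open>Iterated tails reach every position, a nonzero tail signals that the position exists,
  and the length is bounded by the code. Membership thus becomes a bounded search.\<close>

lemma in_list_decode_iff: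
  "x \<in> set (list_decode n) \<longleftrightarrow>
    (\<exists>i<n. (list_code_tl ^^ i) n \<noteq> 0 \<and> fst (prod_decode ((list_code_tl ^^ i) n - 1)) = x)"
proof -
  define xs where "xs = list_decode n"
  have n: "n = list_encode xs" by (simp add: xs_def)
  have pos: "(list_code_tl ^^ i) n \<noteq> 0 \<longleftrightarrow> i < length xs" for i
  proof -
    have "(list_code_tl ^^ i) n = list_encode (drop i xs)"
      by (simp only: n list_code_tl_funpow)
    also have "\<dots> \<noteq> 0 \<longleftrightarrow> drop i xs \<noteq> []"
      by (cases "drop i xs") simp_all
    finally show ?thesis by (simp add: not_le)
  qed
  have hd: "fst (prod_decode ((list_code_tl ^^ i) n - 1)) = xs ! i" if "i < length xs" for i
  proof -
    have "(list_code_tl ^^ i) n = list_encode (xs ! i # drop (Suc i) xs)"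
      by (simp only: n list_code_tl_funpow Cons_nth_drop_Suc[OF that])
    then show ?thesis by simp
  qed
  have "length xs \<le> n" using length_le_list_encode[of xs] by (simp only: n)
  then have "i < length xs \<and> xs ! i = x \<longleftrightarrow>
      i < n \<and> (list_code_tl ^^ i) n \<noteq> 0 \<and> fst (prod_decode ((list_code_tl ^^ i) n - 1)) = x" for i
    unfolding pos using hd[of i] by auto
  then show ?thesis unfolding in_set_conv_nth xs_def[symmetric] by blast
qed

text \<open>Allows quantifiers over the entries of a coded list to be replaced by bounded
  ones.\<close>

lemma in_list_decode_less:
  assumes "x \<in> set (list_decode n)"
  shows "x < n"
proof -
  have "x < list_encode xs" if "x \<in> set xs" for xs
    using that
  proof (induction xs)
    case (Cons y ys)
    then show ?case
      using le_prod_encode_1[of y "list_encode ys"] le_prod_encode_2[of "list_encode ys" y] by auto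
  qed simp
  from this[OF assms] show ?thesis by simp
qed

lemma decidable_in_list_decode:
  assumes "computable k f" "computable k g"
  shows "decidable k (\<lambda>\<rho>. f \<rho> \<in> set (list_decode (g \<rho>)))"
proof (rule computable_comp2[OF _ assms])
  have tl: "computable k (\<lambda>\<rho>. (list_code_tl ^^ f \<rho>) (g \<rho>))"
    if "computable k f" "computable k g" for k f g
  proof -
    have "computable k (\<lambda>\<rho>. rec_nat (g \<rho>) (\<lambda>i y. list_code_tl y) (f \<rho>))"
      unfolding list_code_tl_def
      by (intro computable_rec_nat computable_snd_prod_decode computable_pred computable_var that) simp
    moreover have "rec_nat m (\<lambda>i y. list_code_tl y) n = (list_code_tl ^^ n) m" for m n
      by (induction n) simp_all
    ultimately show ?thesis by simp
  qed
  show "decidable (Suc (Suc 0)) (\<lambda>\<rho>. \<rho> 0 \<in> set (list_decode (\<rho> (Suc 0))))"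
    unfolding in_list_decode_iff
    by (intro computable_intros tl computable_fst_prod_decode; simp)
qed

lemma int_encode_alt:
  "int_encode (int m - int n) = (if n \<le> m then 2 * (m - n) else Suc (2 * (n - m - 1)))"
proof (cases "n \<le> m")
  case True
  then have "int m - int n = int (m - n)" by simp
  then show ?thesis using True by (simp only: int_encode_def sum_encode_def) simp
next
  case False
  then have "- (int m - int n) - 1 = int (n - m - 1)" "\<not> 0 \<le> int m - int n" by simp_all
  then show ?thesis using False by (simp only: int_encode_def sum_encode_def) simp
qed

lemma int_decode_alt:
  "int_decode n = (if odd n then - int (n div 2) - 1 else int (n div 2))"
  by (simp add: int_decode_def sum_decode_def)

definition add_code :: "nat \<Rightarrow> nat \<Rightarrow> nat" where
  "add_code m n = int_encode (int_decode m + int_decode n)"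

definition mod_code :: "nat \<Rightarrow> nat \<Rightarrow> nat" where
  "mod_code n p = nat (int_decode n mod int p)"

lemma computable_add_code:
  assumes "computable k f" "computable k g"
  shows "computable k (\<lambda>\<rho>. add_code (f \<rho>) (g \<rho>))"
proof (rule computable_comp2[OF _ assms])
  \<comment> \<open>\<open>p\<close> and \<open>q\<close> are the positive and the negative part of
    the coded integer, which reduces signed addition to natural numbers.\<close>
  define p where "p = (\<lambda>n::nat. if odd n then 0 else n div 2)"
  define q where "q = (\<lambda>n::nat. if odd n then Suc (n div 2) else 0)"
  have "add_code m n = (if q m + q n \<le> p m + p n then 2 * (p m + p n - (q m + q n))
      else Suc (2 * (q m + q n - (p m + p n) - 1)))" for m n
  proof -
    have "int_decode m + int_decode n = int (p m + p n) - int (q m + q n)"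
      by (simp add: int_decode_alt p_def q_def)
    then show ?thesis by (simp only: add_code_def int_encode_alt)
  qed
  moreover have "computable (Suc (Suc 0)) (\<lambda>\<rho>. if q (\<rho> 0) + q (\<rho> (Suc 0)) \<le> p (\<rho> 0) + p (\<rho> (Suc 0))
      then 2 * (p (\<rho> 0) + p (\<rho> (Suc 0)) - (q (\<rho> 0) + q (\<rho> (Suc 0))))
      else Suc (2 * (q (\<rho> 0) + q (\<rho> (Suc 0)) - (p (\<rho> 0) + p (\<rho> (Suc 0))) - 1)))"
    unfolding p_def q_def
    by (intro computable_intros computable_div decidable_odd; simp)
  ultimately show "computable (Suc (Suc 0)) (\<lambda>\<rho>. add_code (\<rho> 0) (\<rho> (Suc 0)))" by simp
qed

lemma computable_mod_code:
  assumes "computable k f" "computable k g"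
  shows "computable k (\<lambda>\<rho>. mod_code (f \<rho>) (g \<rho>))"
proof (rule computable_comp2[OF _ assms])
  have "mod_code n p = (if p = 0 then (if odd n then 0 else n div 2) else
      if odd n then p - 1 - (n div 2) mod p else (n div 2) mod p)" for n p
  proof (cases "p = 0")
    case True
    then show ?thesis by (simp add: mod_code_def int_decode_alt)
  next
    case p: False
    \<comment> \<open>Odd codes \<open>2 * k + 1\<close> stand for \<open>- k - 1\<close>; this is
      their residue without negative numbers.\<close>
    have "(- int k - 1) mod int p = int (p - 1 - k mod p)" for k
    proof -
      have k: "k mod p < p" using p by simp
      have "(- int k - 1) mod int p = (- int k - 1 + int p * int (Suc (k div p))) mod int p"
        by (rule mod_mult_self2[symmetric])
      also have "- int k - 1 + int p * int (Suc (k div p)) = int (p - 1 - k mod p)"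
      proof -
        have "int k = int p * int (k div p) + int (k mod p)"
          by (simp flip: of_nat_mult of_nat_add)
        moreover have "int (p - 1 - k mod p) = int p - 1 - int (k mod p)"
          using k by linarith
        ultimately show ?thesis by (simp add: algebra_simps)
      qed
      also have "\<dots> mod int p = int (p - 1 - k mod p)"
        using p by (simp flip: of_nat_mod)
      finally show ?thesis .
    qed
    then show ?thesis using p by (simp add: mod_code_def int_decode_alt nat_mod_distrib)
  qed
  moreover have "computable (Suc (Suc 0)) (\<lambda>\<rho>. if \<rho> (Suc 0) = 0
      then (if odd (\<rho> 0) then 0 else \<rho> 0 div 2) else
      if odd (\<rho> 0) then \<rho> (Suc 0) - 1 - (\<rho> 0 div 2) mod \<rho> (Suc 0) else (\<rho> 0 div 2) mod \<rho> (Suc 0))"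
    by (intro computable_intros computable_div computable_mod decidable_odd; simp)
  ultimately show "computable (Suc (Suc 0)) (\<lambda>\<rho>. mod_code (\<rho> 0) (\<rho> (Suc 0)))" by simp
qed

section \<open>Unbounded search\<close>

text \<open>\<open>Mu\<close> searches for a zero, so it is applied to the negation of
  \<open>P\<close>. The test halts on every input, hence the search halts as soon as some witness
  exists, and it returns the least one.\<close>

lemma computable_minimization:
  assumes "decidable (Suc k) (\<lambda>\<rho>. P (\<rho> 0) (\<lambda>n. \<rho> (Suc n)))"
  shows "\<exists>r. \<forall>xs t. length xs = k \<longrightarrow> P t (nth xs) \<longrightarrow> (\<exists>t'. P t' (nth xs) \<and> computes r xs t')"
proof -
  from decidable_not[OF assms] obtain r where
    r: "\<And>xs. length xs = Suc k \<Longrightarrow> computes r xs (of_bool (\<not> P (xs ! 0) (\<lambda>n. xs ! Suc n)))"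
    unfolding computable_def by blast
  have "\<exists>t'. P t' (nth xs) \<and> computes (Mu r) xs t'" if xs: "length xs = k" "P t (nth xs)" for xs t
  proof (intro exI conjI)
    let ?t = "LEAST t. P t (nth xs)"
    show P: "P ?t (nth xs)" using xs(2) by (rule LeastI)
    have *: "computes r (i # xs) (of_bool (\<not> P i (nth xs)))" for i
      using r[of "i # xs"] xs(1) by simp
    show "computes (Mu r) xs ?t"
    proof (rule computes.Mu)
      show "\<forall>i<?t. \<exists>y>0. computes r (i # xs) y"
        using * not_less_Least by (metis (mono_tags, lifting) of_bool_eq_1_iff zero_less_one)
      show "computes r (?t # xs) 0" using *[of ?t] P by simp
    qed
  qed
  then show ?thesis by blast
qed

section \<open>Coverings\<close>

lemma coverings_iff:
  "c \<in> coverings D b a \<longleftrightarrow> range c \<subseteq> {0, 1} \<and>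
     (\<forall>u. card {d\<in>D. c (u + d) = 1} = (if c u = 1 then b else a))"
proof -
  have "card {w \<in> (+) u ` D. c w = 1} = card {d\<in>D. c (u + d) = 1}" for u
  proof -
    have "{w \<in> (+) u ` D. c w = 1} = (+) u ` {d\<in>D. c (u + d) = 1}" by auto
    then show ?thesis by (simp add: card_image)
  qed
  note card_eq = this
  have "(c u = 1 \<longrightarrow> K = b) \<and> (c u = 0 \<longrightarrow> K = a) \<longleftrightarrow> K = (if c u = 1 then b else a)"
    if "range c \<subseteq> {0, 1}" for u K
  proof -
    have "c u = 0 \<or> c u = 1" using that by auto
    then show ?thesis by auto
  qed
  then show ?thesis
    unfolding coverings_def mem_Collect_eq card_eq by (intro conj_cong refl all_cong1)
qed

lemma coverings_card:
  "c \<in> coverings D b a \<Longrightarrow> card {d\<in>D. c (u + d) = 1} = (if c u = 1 then b else a)"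
  unfolding coverings_iff by blast

lemma coverings_values: "c \<in> coverings D b a \<Longrightarrow> c u = 0 \<or> c u = 1"
  by (auto simp: coverings_iff)

text \<open>The covering condition in linear form: \<open>g = f_D - (b - a)\<close> sends every
  covering to the constant \<open>a\<close>, so it annihilates the difference of two
  coverings.\<close>

lemma coverings_sum:
  assumes "c \<in> coverings D b a" "finite D"
  shows "(\<Sum>d\<in>D. int (c (u + d))) = (int b - int a) * int (c u) + int a"
proof -
  have "int (c (u + d)) = (if c (u + d) = 1 then 1 else 0)" for d
    using coverings_values[OF assms(1), of "u + d"] by auto
  then have "(\<Sum>d\<in>D. int (c (u + d))) = int (card {d\<in>D. c (u + d) = 1})"
    using assms(2) by (simp add: sum.If_cases Int_def)
  also have "\<dots> = (int b - int a) * int (c u) + int a"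
    using coverings_card[OF assms(1), of u] coverings_values[OF assms(1), of u] by auto
  finally show ?thesis .
qed

lemma coverings_translate:
  assumes "c \<in> coverings D b a"
  shows "(\<lambda>u. c (t + u)) \<in> coverings D b a"
  unfolding coverings_iff
proof (intro conjI allI)
  show "range (\<lambda>u. c (t + u)) \<subseteq> {0, 1}"
    by (rule image_subsetI) (use coverings_values[OF assms] in blast)
  show "card {d \<in> D. c (t + (u + d)) = 1} = (if c (t + u) = 1 then b else a)" for u
    using coverings_card[OF assms, of "t + u"] by (simp only: add.assoc)
qed

theorem finite_coverings:
  assumes D: "finite D"
    and line: "\<not> (\<exists>h. line_polynomial h \<and> h dvd characteristic_polynomial D - of_int (int b - int a))"
  shows "finite (coverings D b a)"
proof (cases "coverings D b a = {}")
  case False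
  then obtain c0 where c0: "c0 \<in> coverings D b a" by blast
  define S where "S = insert 0 (uminus ` D)"
  \<comment> \<open>\<open>k\<close> lists the coefficients of \<open>g\<close>; at 0 the
    contributions of \<open>D\<close> and of the constant may overlap.\<close>
  define k where "k = (\<lambda>v. of_bool (v \<in> uminus ` D) - of_bool (v = 0) * (int b - int a))"
  define K where "K = {e. (\<forall>u. \<bar>e u\<bar> \<le> 1) \<and> (\<forall>u. (\<Sum>v\<in>S. k v * e (u - v)) = 0)}"
  have S: "finite S" using D by (simp add: S_def)
  \<comment> \<open>Stated for an arbitrary additive \<open>G\<close>, as it is used both for the
    Laurent polynomial itself and for its action on configurations.\<close>
  have sum_k: "(\<Sum>v\<in>S. G v (k v)) = (\<Sum>d\<in>D. G (- d) 1) - G 0 (int b - int a)"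
    if "\<And>v x y. G v (x - y) = G v x - G v y" for G :: "int \<times> int \<Rightarrow> int \<Rightarrow> 'b::ab_group_add"
  proof -
    have G0: "G v 0 = 0" for v using that[of v 0 0] by simp
    have "(\<Sum>v\<in>S. G v (k v)) =
        (\<Sum>v\<in>S. G v (of_bool (v \<in> uminus ` D))) - (\<Sum>v\<in>S. G v (of_bool (v = 0) * (int b - int a)))"
      by (simp add: k_def that sum_subtractf)
    also have "(\<Sum>v\<in>S. G v (of_bool (v \<in> uminus ` D))) = (\<Sum>v\<in>uminus ` D. G v 1)"
      using S by (intro sum.mono_neutral_cong_right) (auto simp: S_def G0)
    also have "\<dots> = (\<Sum>d\<in>D. G (- d) 1)"
      by (subst sum.reindex) (auto simp: inj_on_def)
    also have "(\<Sum>v\<in>S. G v (of_bool (v = 0) * (int b - int a))) =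
        (\<Sum>v\<in>{0}. G v (int b - int a))"
      using S by (intro sum.mono_neutral_cong_right) (auto simp: S_def G0)
    finally show ?thesis by simp
  qed
  have "(\<Sum>v\<in>S. Poly_Mapping.single v (complex_of_int (k v))) =
      characteristic_polynomial D - of_int (int b - int a)"
    by (subst sum_k) (simp_all add: single_diff characteristic_polynomial_def flip: single_of_int)
  then have "finite K"
    unfolding K_def using line S by (intro finite_bounded_annihilated) simp_all
  moreover have "(\<lambda>c u. int (c u) - int (c0 u)) ` coverings D b a \<subseteq> K"
  proof clarify
    fix c assume c: "c \<in> coverings D b a"
    have "\<bar>int (c u) - int (c0 u)\<bar> \<le> 1" for u
      using coverings_values[OF c, of u] coverings_values[OF c0, of u] by auto
    moreover have "(\<Sum>v\<in>S. k v * (int (c (u - v)) - int (c0 (u - v)))) = 0" for u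
    proof -
      have "(\<Sum>v\<in>S. k v * (int (c (u - v)) - int (c0 (u - v)))) =
          (\<Sum>d\<in>D. int (c (u + d)) - int (c0 (u + d))) - (int b - int a) * (int (c u) - int (c0 u))"
        using sum_k[of "\<lambda>v x. x * (int (c (u - v)) - int (c0 (u - v)))"]
        by (simp add: left_diff_distrib)
      then show ?thesis
        by (simp add: sum_subtractf coverings_sum[OF c D] coverings_sum[OF c0 D] right_diff_distrib)
    qed
    ultimately show "(\<lambda>u. int (c u) - int (c0 u)) \<in> K" by (simp add: K_def)
  qed
  ultimately have "finite ((\<lambda>c u. int (c u) - int (c0 u)) ` coverings D b a)"
    by (rule finite_subset[rotated])
  then show ?thesis
    by (rule finite_imageD) (auto simp: inj_on_def fun_eq_iff)
qed simp

section \<open>Common periods and compactness\<close>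

lemma periodic_multiple:
  assumes "\<And>u. c (scale p t + u) = c u"
  shows "c (scale (int k * p) t + u) = c u"
proof (induction k)
  case (Suc k)
  have "scale (int (Suc k) * p) t + u = scale p t + (scale (int k * p) t + u)"
    by (simp add: prod_eq_iff algebra_simps)
  then show ?case by (simp only: assms Suc)
qed simp

text \<open>By the pigeonhole principle two translates of \<open>c\<close> by multiples of
  \<open>t\<close> coincide, which gives \<open>c\<close> a period; the product of these periods
  serves all members of \<open>X\<close>.\<close>

lemma common_period:
  assumes fin: "finite X" and tr: "\<And>c u. c \<in> X \<Longrightarrow> (\<lambda>v. c (u + v)) \<in> X"
  obtains p where "p > 0" "\<And>c u. c \<in> X \<Longrightarrow> c (scale (int p) t + u) = c u"
proof -
  have "\<exists>p>0. \<forall>u. c (scale (int p) t + u) = c u" if c: "c \<in> X" for c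
  proof -
    have "range (\<lambda>n v. c (scale (int n) t + v)) \<subseteq> X"
      by (rule image_subsetI) (rule tr[OF c])
    then have "\<not> inj (\<lambda>n v. c (scale (int n) t + v))"
      using fin finite_subset infinite_UNIV_nat finite_imageD by metis
    then obtain m n where mn: "m < n" "\<And>v. c (scale (int m) t + v) = c (scale (int n) t + v)"
      unfolding inj_def by (metis nat_neq_iff)
    have "c (scale (int (n - m)) t + u) = c u" for u
    proof -
      have "scale (int (n - m)) t + u = scale (int n) t + (u - scale (int m) t)"
        using mn(1) by (simp add: prod_eq_iff of_nat_diff algebra_simps)
      then have "c (scale (int (n - m)) t + u) = c (scale (int m) t + (u - scale (int m) t))"
        by (simp only: mn(2))
      then show ?thesis by simp
    qed
    then show ?thesis using mn(1) by (intro exI[of _ "n - m"]) simp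
  qed
  then obtain p where p: "\<And>c. c \<in> X \<Longrightarrow> p c > 0"
    "\<And>c u. c \<in> X \<Longrightarrow> c (scale (int (p c)) t + u) = c u"
    by metis
  show ?thesis
  proof
    show "(\<Prod>c\<in>X. p c) > 0" using p(1) by (intro prod_pos) blast
    fix c u assume c: "c \<in> X"
    then have "(\<Prod>c\<in>X. p c) = (\<Prod>c\<in>X - {c}. p c) * p c"
      using fin by (simp add: prod.remove mult.commute)
    then show "c (scale (int (\<Prod>c\<in>X. p c)) t + u) = c u"
      using periodic_multiple[of c "int (p c)" t, OF p(2)[OF c]] by (simp only: of_nat_mult)
  qed
qed

lemma periodic_mod:
  fixes f :: "int \<Rightarrow> 'a"
  assumes "\<And>i. f (p + i) = f i"
  shows "f (i mod p) = f i"
proof -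
  have nat: "f (int k * p + i) = f i" for k i
  proof (induction k)
    case (Suc k)
    have "int (Suc k) * p + i = p + (int k * p + i)" by (simp add: algebra_simps)
    then show ?case by (simp only: assms Suc)
  qed simp
  show ?thesis
  proof (cases "i div p \<ge> 0")
    case True
    have "i = int (nat (i div p)) * p + i mod p" using True by simp
    then show ?thesis using nat[of "nat (i div p)" "i mod p"] by simp
  next
    case False
    have "i mod p = int (nat (- (i div p))) * p + i"
      using False by (simp add: minus_mult_div_eq_mod[symmetric] mult.commute)
    then show ?thesis by (simp only: nat)
  qed
qed

text \<open>Compactness of the Cantor space: \<open>C\<close> is a limit point of the sequence
  \<open>s\<close>, built bit by bit so that each prefix is shared by \<open>s n\<close> for
  arbitrarily large \<open>n\<close>.\<close>

lemma binary_sequence_compact: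
  fixes s :: "nat \<Rightarrow> nat \<Rightarrow> bool"
  obtains C where "\<And>K N. \<exists>n\<ge>N. \<forall>k<K. s n k = C k"
proof -
  let ?P = "\<lambda>K x. \<forall>N. \<exists>n\<ge>N. \<forall>k<K. s n k = x k"
  have "\<exists>f. \<forall>K. ?P K (f K) \<and> (\<forall>k<K. f K k = f (Suc K) k)"
  proof (rule dependent_nat_choice)
    show "\<exists>x. ?P 0 x" by auto
    fix x K assume P: "?P K x"
    have "\<exists>b. ?P (Suc K) (x(K := b))"
    proof (rule ccontr)
      assume "\<not> ?thesis"
      then have "\<forall>b. \<exists>N. \<forall>n\<ge>N. \<exists>k<Suc K. s n k \<noteq> (x(K := b)) k" by blast
      then obtain N where N: "\<And>b n. n \<ge> N b \<Longrightarrow> \<exists>k<Suc K. s n k \<noteq> (x(K := b)) k" by metis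
      \<comment> \<open>If either bit failed from some index on, a later \<open>s n\<close> with the
        right prefix would be refuted by its own bit \<open>s n K\<close>.\<close>
      obtain n where n: "n \<ge> max (N True) (N False)" "\<forall>k<K. s n k = x k" using P by blast
      have "n \<ge> N (s n K)" using n(1) by (cases "s n K") auto
      from N[OF this] n(2) show False by (auto simp: less_Suc_eq)
    qed
    then obtain b where "?P (Suc K) (x(K := b))" ..
    then show "\<exists>y. ?P (Suc K) y \<and> (\<forall>k<K. x k = y k)"
      by (intro exI[of _ "x(K := b)"]) auto
  qed
  then obtain f where f: "\<forall>K. ?P K (f K) \<and> (\<forall>k<K. f K k = f (Suc K) k)" ..
  have stable: "f K k = f (Suc k) k" if "k < K" for K k
  proof -
    from that have "Suc k \<le> K" by simp
    then show ?thesis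
    proof (induction K rule: dec_induct)
      case (step n)
      then show ?case using f[THEN spec, of n, THEN conjunct2] by simp
    qed simp
  qed
  have "\<exists>n\<ge>N. \<forall>k<K. s n k = f (Suc k) k" for K N
  proof -
    obtain n where n: "n \<ge> N" "\<forall>k<K. s n k = f K k"
      using f[THEN spec, of K, THEN conjunct1, THEN spec, of N] by blast
    have "s n k = f (Suc k) k" if "k < K" for k
      using n(2) that stable[OF that] by simp
    with n(1) show ?thesis by blast
  qed
  then show ?thesis by (rule that)
qed

section \<open>Certificates\<close>

definition encode_cell :: "int \<times> int \<Rightarrow> nat" where
  "encode_cell u = prod_encode (int_encode (fst u), int_encode (snd u))"

definition decode_cell :: "nat \<Rightarrow> int \<times> int" where
  "decode_cell k = (int_decode (fst (prod_decode k)), int_decode (snd (prod_decode k)))"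

lemma decode_encode_cell [simp]: "decode_cell (encode_cell u) = u"
  by (simp add: encode_cell_def decode_cell_def)

lemma encode_decode_cell [simp]: "encode_cell (decode_cell k) = k"
  by (simp add: encode_cell_def decode_cell_def)

lemma encode_cell_eq_iff [simp]: "encode_cell u = encode_cell v \<longleftrightarrow> u = v"
  by (metis decode_encode_cell)

text \<open>Accounts for the doubled coordinates in \<open>certificate\<close>.\<close>

lemma encode_cell_of_nat: "encode_cell (int i, int j) = prod_encode (2 * i, 2 * j)"
  by (simp add: encode_cell_def int_encode_def sum_encode_def)

lemma encode_shape_eq: "encode_shape ds = list_encode (map encode_cell ds)"
  by (simp add: encode_shape_def encode_cell_def[abs_def] case_prod_beta')

definition add_cell_code :: "nat \<Rightarrow> nat \<Rightarrow> nat" where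
  "add_cell_code k l = prod_encode
     (add_code (fst (prod_decode k)) (fst (prod_decode l)),
      add_code (snd (prod_decode k)) (snd (prod_decode l)))"

lemma add_cell_code_encode [simp]:
  "add_cell_code (encode_cell u) (encode_cell v) = encode_cell (u + v)"
  by (simp add: add_cell_code_def encode_cell_def add_code_def)

text \<open>The covering condition at one cell, in terms of codes. The sum runs over all numbers
  below \<open>E\<close> so that the rule stays within the computable operations.\<close>

definition local_rule :: "nat \<Rightarrow> nat \<Rightarrow> nat \<Rightarrow> (nat \<Rightarrow> bool) \<Rightarrow> nat \<Rightarrow> bool" where
  "local_rule E b a C k \<longleftrightarrow>
     (\<Sum>d<E. of_bool (d \<in> set (list_decode E) \<and> C (add_cell_code k d))) = (if C k then b else a)"

lemma local_rule_encode:
  "local_rule (encode_shape ds) b a C (encode_cell u) \<longleftrightarrow>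
     card {d\<in>set ds. C (encode_cell (u + d))} = (if C (encode_cell u) then b else a)"
proof -
  let ?E = "encode_shape ds"
  have set: "set (list_decode ?E) = encode_cell ` set ds"
    by (simp add: encode_shape_eq)
  have "(\<Sum>d<?E. of_bool (d \<in> set (list_decode ?E) \<and> C (add_cell_code (encode_cell u) d)) :: nat) =
      card {d. d < ?E \<and> d \<in> set (list_decode ?E) \<and> C (add_cell_code (encode_cell u) d)}"
    by (simp add: of_bool_def sum.If_cases Int_def)
  also have "{d. d < ?E \<and> d \<in> set (list_decode ?E) \<and> C (add_cell_code (encode_cell u) d)} =
      encode_cell ` {d\<in>set ds. C (encode_cell (u + d))}"
    using in_list_decode_less[of _ ?E] by (auto simp: set)
  also have "card \<dots> = card {d\<in>set ds. C (encode_cell (u + d))}"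
    by (rule card_image) (auto simp: inj_on_def)
  finally show ?thesis by (simp add: local_rule_def)
qed

lemma coverings_iff_local_rule:
  assumes "range c \<subseteq> {0, 1}"
  shows "c \<in> coverings (set ds) b a \<longleftrightarrow>
    (\<forall>k. local_rule (encode_shape ds) b a (\<lambda>k. c (decode_cell k) = 1) k)"
proof -
  have "(\<forall>k. local_rule (encode_shape ds) b a (\<lambda>k. c (decode_cell k) = 1) k) \<longleftrightarrow>
      (\<forall>u. local_rule (encode_shape ds) b a (\<lambda>k. c (decode_cell k) = 1) (encode_cell u))"
    by (metis encode_decode_cell)
  then show ?thesis using assms by (simp add: coverings_iff local_rule_encode)
qed

lemma local_rule_cong:
  assumes "C k = C' k" "\<And>d. d \<in> set (list_decode E) \<Longrightarrow> C (add_cell_code k d) = C' (add_cell_code k d)"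
  shows "local_rule E b a C k = local_rule E b a C' k"
  unfolding local_rule_def using assms by (simp cong: conj_cong)

definition pattern :: "nat \<Rightarrow> nat \<Rightarrow> bool" where
  "pattern m k \<longleftrightarrow> odd (m div 2 ^ k)"

definition periodic_pattern :: "nat \<Rightarrow> nat \<Rightarrow> nat \<Rightarrow> bool" where
  "periodic_pattern p cs k \<longleftrightarrow> prod_encode
     (mod_code (fst (prod_decode k)) p, mod_code (snd (prod_decode k)) p) \<in> set (list_decode cs)"

abbreviation cells_code :: "nat \<Rightarrow> nat" where
  "cells_code x \<equiv> snd (prod_decode (snd (prod_decode x)))"

definition decode_description :: "nat \<Rightarrow> description" where
  "decode_description x =
     (fst (prod_decode x), fst (prod_decode (snd (prod_decode x))),
      map prod_decode (list_decode (cells_code x)))"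

lemma encode_decode_description [simp]: "encode_description (decode_description x) = x"
  by (simp add: decode_description_def o_def)

lemma described_config_periodic_pattern:
  assumes "fst (prod_decode x) = p" "fst (prod_decode (snd (prod_decode x))) = p"
  shows "described_config (decode_description x) u = of_bool (periodic_pattern p (cells_code x) (encode_cell u))"
proof (cases u)
  case (Pair i j)
  have "(m, n) \<in> prod_decode ` A \<longleftrightarrow> prod_encode (m, n) \<in> A" for m n A
    by (force intro: rev_image_eqI)
  then show ?thesis using assms
    by (simp add: Pair decode_description_def periodic_pattern_def encode_cell_def mod_code_def)
qed

text \<open>The number is \<open>set_encode\<close> of the chosen positions. It turns quantification
  over all patterns in a window into a bounded quantifier.\<close>

lemma ex_pattern: "\<exists>m<2 ^ n. \<forall>k. pattern m k \<longleftrightarrow> k < n \<and> C k"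
proof -
  define X where "X = {k. k < n \<and> C k}"
  have X: "finite X" "X \<subseteq> {..<n}" by (auto simp: X_def)
  have "set_encode X = (\<Sum>k\<in>X. 2 ^ k)" by (simp add: set_encode_def)
  also have "\<dots> \<le> (\<Sum>k<n. 2 ^ k)" using X by (intro sum_mono2) auto
  also have "\<dots> < 2 ^ n" by (induction n) simp_all
  finally have "set_encode X < 2 ^ n" .
  moreover have "pattern (set_encode X) k \<longleftrightarrow> k < n \<and> C k" for k
    using set_encode_inverse[OF X(1)] unfolding set_decode_def pattern_def X_def by blast
  ultimately show ?thesis by blast
qed

text \<open>
  \<open>L\<close> is a list of codes of \<open>p\<close>-periodic coverings. The patterns \<open>m\<close> are the sets of cells with code
  below \<open>n\<close>; each one that satisfies the local rule wherever it can be checked inside this window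
  agrees on \<open>{0..p}\<^sup>2\<close> with a listed covering. Since the square is closed, applying this to all
  translates of a covering shows that the covering is \<open>p\<close>-periodic.
\<close>

definition certificate :: "nat \<Rightarrow> nat \<Rightarrow> nat \<Rightarrow> nat \<Rightarrow> nat \<Rightarrow> nat \<Rightarrow> bool" where
  "certificate L p n E b a \<longleftrightarrow> 0 < p \<and>
     (\<forall>x<L. x \<in> set (list_decode L) \<longrightarrow>
        fst (prod_decode x) = p \<and> fst (prod_decode (snd (prod_decode x))) = p \<and>
        (\<forall>y<cells_code x. y \<in> set (list_decode (cells_code x)) \<longrightarrow>
           fst (prod_decode y) < p \<and> snd (prod_decode y) < p) \<and>
        (\<forall>i<p. \<forall>j<p. local_rule E b a (periodic_pattern p (cells_code x)) (prod_encode (2 * i, 2 * j)))) \<and>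
     (\<forall>i<Suc p. \<forall>j<Suc p. prod_encode (2 * i, 2 * j) < n) \<and>
     (\<forall>m<2 ^ n.
        (\<forall>k<n. (\<forall>d<E. d \<in> set (list_decode E) \<longrightarrow> add_cell_code k d < n) \<longrightarrow>
           local_rule E b a (pattern m) k) \<longrightarrow>
        (\<exists>x<L. x \<in> set (list_decode L) \<and>
           (\<forall>i<Suc p. \<forall>j<Suc p. pattern m (prod_encode (2 * i, 2 * j)) \<longleftrightarrow>
              periodic_pattern p (cells_code x) (prod_encode (2 * i, 2 * j)))))"

text \<open>Listed configurations are coverings, as periodicity carries the rule from the
  fundamental square to all cells. Conversely every translate of a covering passes the window test
  and so matches a listed configuration on the closed square; this forces period \<open>p\<close>
  and then identifies the covering.\<close>

lemma certificate_sound: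
  assumes "certificate L p n (encode_shape ds) b a"
  shows "\<exists>ps. encode_descriptions ps = L \<and> (\<forall>q\<in>set ps. valid_description q) \<and>
    described_config ` set ps = coverings (set ds) b a"
proof -
  let ?E = "encode_shape ds"
  define ps where "ps = map decode_description (list_decode L)"
  note cert = assms[unfolded certificate_def encode_cell_of_nat[symmetric]]
  have p: "p > 0" using cert by (rule conjunct1)
  have x: "fst (prod_decode x) = p" "fst (prod_decode (snd (prod_decode x))) = p"
    "\<And>y. y \<in> set (list_decode (cells_code x)) \<Longrightarrow> fst (prod_decode y) < p \<and> snd (prod_decode y) < p"
    "\<And>i j. i < p \<Longrightarrow> j < p \<Longrightarrow>
      local_rule ?E b a (periodic_pattern p (cells_code x)) (encode_cell (int i, int j))"
    if "x \<in> set (list_decode L)" for x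
  proof -
    note X = cert[THEN conjunct2, THEN conjunct1, THEN spec, THEN mp, THEN mp, OF in_list_decode_less[OF that] that]
    show "fst (prod_decode x) = p" "fst (prod_decode (snd (prod_decode x))) = p"
      using X by simp_all
    show "fst (prod_decode y) < p \<and> snd (prod_decode y) < p" if "y \<in> set (list_decode (cells_code x))" for y
      using X in_list_decode_less[OF that] that by simp
    show "local_rule ?E b a (periodic_pattern p (cells_code x)) (encode_cell (int i, int j))"
      if "i < p" "j < p" for i j
      using X that by simp
  qed
  have n: "\<And>i j. i \<le> p \<Longrightarrow> j \<le> p \<Longrightarrow> encode_cell (int i, int j) < n"
    using cert[THEN conjunct2, THEN conjunct2, THEN conjunct1] by (simp add: less_Suc_eq_le)
  have m: "\<exists>x\<in>set (list_decode L). \<forall>i\<le>p. \<forall>j\<le>p. pattern m (encode_cell (int i, int j)) \<longleftrightarrow>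
      periodic_pattern p (cells_code x) (encode_cell (int i, int j))"
    if "m < 2 ^ n" "\<And>k. k < n \<Longrightarrow> (\<And>d. d \<in> set (list_decode ?E) \<Longrightarrow> add_cell_code k d < n) \<Longrightarrow>
      local_rule ?E b a (pattern m) k" for m
  proof -
    have "\<forall>k<n. (\<forall>d<?E. d \<in> set (list_decode ?E) \<longrightarrow> add_cell_code k d < n) \<longrightarrow>
        local_rule ?E b a (pattern m) k"
      using that(2) in_list_decode_less by blast
    with cert[THEN conjunct2, THEN conjunct2, THEN conjunct2, THEN spec, THEN mp, OF that(1)] show ?thesis
      unfolding less_Suc_eq_le by blast
  qed
  have mod_mod: "periodic_pattern p cs (encode_cell (i mod int p, j mod int p)) =
      periodic_pattern p cs (encode_cell (i, j))" for cs i j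
    by (simp add: periodic_pattern_def encode_cell_def mod_code_def)
  have in_cov: "described_config (decode_description x) \<in> coverings (set ds) b a"
    if "x \<in> set (list_decode L)" for x
  proof -
    let ?C = "periodic_pattern p (cells_code x)"
    have eq: "described_config (decode_description x) u = of_bool (?C (encode_cell u))" for u
      by (rule described_config_periodic_pattern[OF x(1,2)[OF that]])
    have "card {d\<in>set ds. ?C (encode_cell (u + d))} = (if ?C (encode_cell u) then b else a)" for u
    proof -
      obtain i j where u: "u = (i, j)" by fastforce
      have "?C (encode_cell ((i mod int p, j mod int p) + d)) = ?C (encode_cell (u + d))" for d
        using mod_mod[of "cells_code x" "i mod int p + fst d" "j mod int p + snd d"]
          mod_mod[of "cells_code x" "i + fst d" "j + snd d"]
        by (cases d) (simp add: u mod_add_left_eq)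
      from this this[of 0] show ?thesis
        using x(4)[OF that, of "nat (i mod int p)" "nat (j mod int p)"] p
        by (simp add: local_rule_encode nat_less_iff)
    qed
    moreover have "range (\<lambda>u. of_bool (?C (encode_cell u))) \<subseteq> {0, 1 :: nat}" by auto
    ultimately show ?thesis
      unfolding coverings_iff eq[abs_def] of_bool_eq_1_iff by blast
  qed
  have covers: "c \<in> described_config ` set ps" if c: "c \<in> coverings (set ds) b a" for c
  proof -
    \<comment> \<open>The translate is cut off to the codes below \<open>n\<close>; where all
      neighbours lie in the window, the cut-off does not affect the local rule.\<close>
    have window: "\<exists>x\<in>set (list_decode L). \<forall>i\<le>p. \<forall>j\<le>p. c (t + (int i, int j)) =
        described_config (decode_description x) (int i, int j)" for t
    proof -
      define C where "C = (\<lambda>k. c (t + decode_cell k) = 1)"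
      obtain m where m': "m < 2 ^ n" "\<And>k. pattern m k \<longleftrightarrow> k < n \<and> C k"
        using ex_pattern by blast
      have rule: "local_rule ?E b a C k" for k
      proof -
        have "range (\<lambda>u. c (t + u)) \<subseteq> {0, 1}"
          by (rule image_subsetI) (use coverings_values[OF c] in blast)
        with coverings_translate[OF c, of t] show ?thesis
          unfolding C_def using coverings_iff_local_rule by blast
      qed
      have "local_rule ?E b a (pattern m) k"
        if "k < n" "\<And>d. d \<in> set (list_decode ?E) \<Longrightarrow> add_cell_code k d < n" for k
        using rule[of k] by (subst local_rule_cong[of _ _ C]) (simp_all add: m' that)
      from m[OF m'(1) this] obtain x' where x': "x' \<in> set (list_decode L)"
        "\<forall>i\<le>p. \<forall>j\<le>p. pattern m (encode_cell (int i, int j)) \<longleftrightarrow>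
          periodic_pattern p (cells_code x') (encode_cell (int i, int j))"
        by blast
      have "c (t + (int i, int j)) = described_config (decode_description x') (int i, int j)"
        if "i \<le> p" "j \<le> p" for i j
      proof -
        have "c (t + (int i, int j)) = of_bool (C (encode_cell (int i, int j)))"
          using coverings_values[OF c, of "t + (int i, int j)"] by (auto simp: C_def)
        also have "C (encode_cell (int i, int j)) \<longleftrightarrow> pattern m (encode_cell (int i, int j))"
          using n[OF that] by (simp add: m'(2))
        finally show ?thesis
          using x'(2) that by (simp add: described_config_periodic_pattern[OF x(1,2)[OF x'(1)]])
      qed
      with x'(1) show ?thesis by blast
    qed
    have corner: "described_config (decode_description x) (int p, 0) =
        described_config (decode_description x) (0, 0)"
      "described_config (decode_description x) (0, int p) =
        described_config (decode_description x) (0, 0)" if "x \<in> set (list_decode L)" for x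
      using mod_mod[of "cells_code x" "int p" 0] mod_mod[of "cells_code x" 0 "int p"]
      by (simp_all add: described_config_periodic_pattern[OF x(1,2)[OF that]])
    \<comment> \<open>The corners of a single square are compared, but \<open>t\<close> is
      arbitrary, so this yields both periods everywhere. The matching \<open>x'\<close> may vary
      with \<open>t\<close>.\<close>
    have per: "c (t + (int p, 0)) = c t" "c (t + (0, int p)) = c t" for t
    proof -
      obtain x' where x': "x' \<in> set (list_decode L)" "\<forall>i\<le>p. \<forall>j\<le>p. c (t + (int i, int j)) =
        described_config (decode_description x') (int i, int j)" using window by blast
      have "c (t + (int 0, int 0)) = described_config (decode_description x') (int 0, int 0)"
        "c (t + (int p, int 0)) = described_config (decode_description x') (int p, int 0)"
        "c (t + (int 0, int p)) = described_config (decode_description x') (int 0, int p)"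
        using x'(2) by blast+
      then show "c (t + (int p, 0)) = c t" "c (t + (0, int p)) = c t"
        using corner[OF x'(1)] by (simp_all flip: zero_prod_def)
    qed
    have red: "c (i mod int p, j mod int p) = c (i, j)" for i j
    proof -
      have "c (i mod int p, j mod int p) = c (i, j mod int p)"
        by (rule periodic_mod) (use per(1)[of "(_, j mod int p)"] in \<open>simp add: add.commute\<close>)
      also have "\<dots> = c (i, j)"
        by (rule periodic_mod) (use per(2)[of "(i, _)"] in \<open>simp add: add.commute\<close>)
      finally show ?thesis .
    qed
    obtain x' where x': "x' \<in> set (list_decode L)" "\<forall>i\<le>p. \<forall>j\<le>p. c (0 + (int i, int j)) =
      described_config (decode_description x') (int i, int j)" using window by blast
    have "c (i, j) = described_config (decode_description x') (i, j)" for i j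
    proof -
      have "c (i, j) = c (0 + (int (nat (i mod int p)), int (nat (j mod int p))))"
        using p by (simp add: red)
      also have "\<dots> = described_config (decode_description x') (int (nat (i mod int p)), int (nat (j mod int p)))"
        using p pos_mod_bound[of "int p" i] pos_mod_bound[of "int p" j]
        by (intro x'(2)[rule_format]) (simp_all add: nat_le_iff less_imp_le)
      also have "\<dots> = described_config (decode_description x') (i, j)"
        using p mod_mod[of "cells_code x'" i j]
        by (simp add: described_config_periodic_pattern[OF x(1,2)[OF x'(1)]])
      finally show ?thesis .
    qed
    then have "c = described_config (decode_description x')" by (auto simp: fun_eq_iff)
    then show ?thesis using x'(1) by (simp add: ps_def)
  qed
  have "encode_descriptions ps = L"
    by (simp add: ps_def encode_descriptions_def o_def)
  moreover have "valid_description q" if "q \<in> set ps" for q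
  proof -
    from that obtain x' where x': "x' \<in> set (list_decode L)" "q = decode_description x'"
      by (auto simp: ps_def)
    have "set (map prod_decode (list_decode (cells_code x'))) \<subseteq> {..<p} \<times> {..<p}"
      by (simp add: image_subset_iff mem_Times_iff x(3)[OF x'(1)])
    then show ?thesis
      using p x(1,2)[OF x'(1)] by (simp add: x'(2) decode_description_def)
  qed
  moreover have "described_config ` set ps = coverings (set ds) b a"
    using in_cov covers by (auto simp: ps_def)
  ultimately show ?thesis by blast
qed

text \<open>Finiteness gives a common period and hence a list of descriptions. If no window were
  large enough, bad patterns on growing windows would have a limit that is a covering, contradicting
  their badness on the square.\<close>

lemma certificate_complete:
  assumes fin: "finite (coverings (set ds) b a)"
  shows "\<exists>L p n. certificate L p n (encode_shape ds) b a"
proof -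
  let ?E = "encode_shape ds" and ?X = "coverings (set ds) b a"
  obtain p1 where p1: "p1 > 0" "\<And>c u. c \<in> ?X \<Longrightarrow> c (scale (int p1) (1, 0) + u) = c u"
    using common_period[OF fin coverings_translate] by blast
  obtain p2 where p2: "p2 > 0" "\<And>c u. c \<in> ?X \<Longrightarrow> c (scale (int p2) (0, 1) + u) = c u"
    using common_period[OF fin coverings_translate] by blast
  define p where "p = p1 * p2"
  have p: "p > 0" using p1 p2 by (simp add: p_def)
  have red: "c (i mod int p, j mod int p) = c (i, j)" if c: "c \<in> ?X" for c i j
  proof -
    have per: "c (int p + i, j) = c (i, j)" "c (i, int p + j) = c (i, j)" for i j
      using periodic_multiple[of c "int p1" "(1, 0)" p2 "(i, j)", OF p1(2)[OF c]]
        periodic_multiple[of c "int p2" "(0, 1)" p1 "(i, j)", OF p2(2)[OF c]]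
      by (simp_all add: p_def scale_def mult.commute)
    have "c (i mod int p, j mod int p) = c (i, j mod int p)"
      by (rule periodic_mod) (rule per)
    also have "\<dots> = c (i, j)"
      by (rule periodic_mod) (rule per)
    finally show ?thesis .
  qed
  define cells where "cells = (\<lambda>c. SOME l. set l = {(i, j). i < p \<and> j < p \<and> c (int i, int j) = (1::nat)})"
  have cells: "set (cells c) = {(i, j). i < p \<and> j < p \<and> c (int i, int j) = 1}" for c
  proof -
    have "finite {(i, j). i < p \<and> j < p \<and> c (int i, int j) = 1}"
      by (rule finite_subset[of _ "{..<p} \<times> {..<p}"]) auto
    then show ?thesis unfolding cells_def by (rule someI_ex[OF finite_list])
  qed
  define code where "code = (\<lambda>c. encode_description (p, p, cells c))"
  obtain cs where cs: "set cs = ?X" using finite_list[OF fin] by blast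
  define L where "L = list_encode (map code cs)"
  have L: "set (list_decode L) = code ` ?X" by (simp add: L_def cs)
  have code: "fst (prod_decode (code c)) = p" "fst (prod_decode (snd (prod_decode (code c)))) = p"
    "set (list_decode (cells_code (code c))) = prod_encode ` {(i, j). i < p \<and> j < p \<and> c (int i, int j) = 1}" for c
    by (simp_all add: code_def cells)
  have pp: "periodic_pattern p (cells_code (code c)) (encode_cell u) \<longleftrightarrow> c u = 1"
    if c: "c \<in> ?X" for c u
  proof (cases u)
    case (Pair i j)
    have "periodic_pattern p (cells_code (code c)) (encode_cell u) \<longleftrightarrow>
        c (int (nat (i mod int p)), int (nat (j mod int p))) = 1"
      using p by (auto simp: periodic_pattern_def code Pair encode_cell_def mod_code_def nat_less_iff)
    then show ?thesis using p red[OF c] by (simp add: Pair)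
  qed
  \<comment> \<open>\<open>W\<close> exceeds the codes of all cells of the closed square
    \<open>{0..p}\<close> by \<open>{0..p}\<close>.\<close>
  define W where "W = Suc (\<Sum>i\<le>p. \<Sum>j\<le>p. encode_cell (int i, int j))"
  have W: "encode_cell (int i, int j) < W" if "i \<le> p" "j \<le> p" for i j
  proof -
    have "encode_cell (int i, int j) \<le> (\<Sum>j\<le>p. encode_cell (int i, int j))"
      using that by (intro member_le_sum) auto
    also have "\<dots> \<le> (\<Sum>i\<le>p. \<Sum>j\<le>p. encode_cell (int i, int j))"
      using that by (intro member_le_sum[of i _ "\<lambda>i. \<Sum>j\<le>p. encode_cell (int i, int j)"]) auto
    finally show ?thesis by (simp add: W_def)
  qed
  \<comment> \<open>A bad \<open>C\<close> obeys every rule that can be checked below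
    \<open>n\<close>, yet agrees with no covering on the closed square.\<close>
  define bad where "bad = (\<lambda>n C.
    (\<forall>k<n. (\<forall>d\<in>set (list_decode ?E). add_cell_code k d < n) \<longrightarrow> local_rule ?E b a C k) \<and>
    \<not> (\<exists>c\<in>?X. \<forall>i\<le>p. \<forall>j\<le>p. C (encode_cell (int i, int j)) \<longleftrightarrow> c (int i, int j) = 1))"
  have "\<exists>n\<ge>W. \<forall>C. \<not> bad n C"
  proof (rule ccontr)
    assume "\<not> ?thesis"
    then obtain s where s: "\<And>n. n \<ge> W \<Longrightarrow> bad n (s n)" by metis
    obtain C where C: "\<And>K N. \<exists>n\<ge>N. \<forall>k<K. s n k = C k"
      using binary_sequence_compact by blast
    define c where "c = (\<lambda>u. of_bool (C (encode_cell u)) :: nat)"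
    have Cc: "(\<lambda>k. c (decode_cell k) = 1) = C" by (simp add: c_def)
    have "local_rule ?E b a C k" for k
    proof -
      \<comment> \<open>\<open>K\<close> lies above \<open>k\<close> and all its neighbours, so
        agreement below \<open>K\<close> carries the local rule at \<open>k\<close> over to the
        limit.\<close>
      define K where "K = Suc (k + (\<Sum>d\<in>set (list_decode ?E). add_cell_code k d))"
      have K: "k < K" "\<And>d. d \<in> set (list_decode ?E) \<Longrightarrow> add_cell_code k d < K"
        using member_le_sum[of _ "set (list_decode ?E)" "add_cell_code k"]
        by (auto simp: K_def less_Suc_eq_le trans_le_add2)
      obtain n where n: "n \<ge> max K W" "\<And>k. k < K \<Longrightarrow> s n k = C k" using C by blast
      have "K \<le> n" "W \<le> n" using n(1) by simp_all
      have "local_rule ?E b a (s n) k"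
      proof -
        have "k < n" "\<forall>d\<in>set (list_decode ?E). add_cell_code k d < n"
          using K \<open>K \<le> n\<close> by (simp, meson less_le_trans)
        with s[OF \<open>W \<le> n\<close>] show ?thesis unfolding bad_def by blast
      qed
      then show ?thesis
        using local_rule_cong[of "s n" k C ?E b a] n(2) K by simp
    qed
    then have c: "c \<in> ?X"
      by (subst coverings_iff_local_rule) (auto simp: Cc, auto simp: c_def)
    obtain n where n: "n \<ge> W" "\<And>k. k < W \<Longrightarrow> s n k = C k" using C by blast
    \<comment> \<open>Agreement of \<open>s n\<close> with the limit below \<open>W\<close> covers
      the whole square, so \<open>s n\<close> matches the covering \<open>c\<close> there.\<close>
    have "\<forall>i\<le>p. \<forall>j\<le>p. s n (encode_cell (int i, int j)) \<longleftrightarrow> c (int i, int j) = 1"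
      using n(2) W by (simp add: c_def)
    with c s[OF n(1)] show False unfolding bad_def by blast
  qed
  then obtain n where n: "n \<ge> W" "\<And>C. \<not> bad n C" by blast
  have "certificate L p n ?E b a"
    unfolding certificate_def encode_cell_of_nat[symmetric]
  proof (intro conjI allI impI)
    fix x assume "x < L" "x \<in> set (list_decode L)"
    then obtain c where c: "c \<in> ?X" "x = code c" by (auto simp: L)
    show "fst (prod_decode x) = p" "fst (prod_decode (snd (prod_decode x))) = p"
      by (simp_all only: c code)
    show "fst (prod_decode y) < p" "snd (prod_decode y) < p"
      if "y \<in> set (list_decode (cells_code x))" for y
      using that by (auto simp only: c code) auto
    show "local_rule ?E b a (periodic_pattern p (cells_code x)) (encode_cell (int i, int j))" for i j
      using c by (auto simp: local_rule_encode pp coverings_iff)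
  next
    show "encode_cell (int i, int j) < n" if "i < Suc p" "j < Suc p" for i j
      using W[of i j] n(1) that by simp
  next
    fix m
    assume "\<forall>k<n. (\<forall>d<?E. d \<in> set (list_decode ?E) \<longrightarrow> add_cell_code k d < n) \<longrightarrow>
      local_rule ?E b a (pattern m) k"
    then obtain c where c: "c \<in> ?X" "\<forall>i\<le>p. \<forall>j\<le>p. pattern m (encode_cell (int i, int j)) \<longleftrightarrow> c (int i, int j) = 1"
      using n(2)[of "pattern m"] unfolding bad_def by blast
    then have "code c \<in> set (list_decode L)" by (simp add: L)
    moreover from this have "code c < L" by (rule in_list_decode_less)
    ultimately show "\<exists>x<L. x \<in> set (list_decode L) \<and>
        (\<forall>i<Suc p. \<forall>j<Suc p. pattern m (encode_cell (int i, int j)) \<longleftrightarrow>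
          periodic_pattern p (cells_code x) (encode_cell (int i, int j)))"
      using c by (intro exI[of _ "code c"]) (simp add: pp less_Suc_eq_le)
  qed (use p in simp)
  then show ?thesis by blast
qed

text \<open>All quantifiers in \<open>certificate\<close> are bounded, so the closure rules decide
  it, first for six variables and then by composition.\<close>

lemma decidable_certificate:
  assumes "computable k L" "computable k p" "computable k n" "computable k E" "computable k b" "computable k a"
  shows "decidable k (\<lambda>\<rho>. certificate (L \<rho>) (p \<rho>) (n \<rho>) (E \<rho>) (b \<rho>) (a \<rho>))"
proof -
  have "decidable (Suc (Suc (Suc (Suc (Suc (Suc 0)))))) (\<lambda>\<rho>. certificate (\<rho> 0) (\<rho> (Suc 0)) (\<rho> (Suc (Suc 0))) (\<rho> (Suc (Suc (Suc 0))))
      (\<rho> (Suc (Suc (Suc (Suc 0))))) (\<rho> (Suc (Suc (Suc (Suc (Suc 0)))))))"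
    unfolding certificate_def local_rule_def pattern_def periodic_pattern_def add_cell_code_def
    by (intro computable_intros computable_prod_encode computable_fst_prod_decode
        computable_snd_prod_decode decidable_in_list_decode computable_add_code computable_mod_code
        decidable_odd computable_div; simp)
  then show ?thesis
    using computable_comp[of "[L, p, n, E, b, a]" "\<lambda>\<rho>. of_bool (certificate (\<rho> 0) (\<rho> (Suc 0))
      (\<rho> (Suc (Suc 0))) (\<rho> (Suc (Suc (Suc 0)))) (\<rho> (Suc (Suc (Suc (Suc 0)))))
      (\<rho> (Suc (Suc (Suc (Suc (Suc 0)))))))" k] assms by auto
qed

section \<open>Finiteness and effective construction of all coverings\<close>

theorem theorem16:
  shows
    "(\<forall>D b a. finite D \<longrightarrow>
        \<not> (\<exists>h. line_polynomial h \<and>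
              h dvd characteristic_polynomial D - of_int (int b - int a)) \<longrightarrow>
        finite (coverings D b a)) \<and>
     (\<exists>F. \<forall>ds b a.
        \<not> (\<exists>h. line_polynomial h \<and>
              h dvd characteristic_polynomial (set ds) - of_int (int b - int a)) \<longrightarrow>
        (\<exists>ps. computes F [encode_shape ds, b, a] (encode_descriptions ps) \<and>
              (\<forall>p\<in>set ps. valid_description p) \<and>
              described_config ` set ps = coverings (set ds) b a))"
proof
  show "\<forall>D b a. finite D \<longrightarrow>
        \<not> (\<exists>h. line_polynomial h \<and>
              h dvd characteristic_polynomial D - of_int (int b - int a)) \<longrightarrow>
        finite (coverings D b a)"
    using finite_coverings by blast
next
  \<comment> \<open>The search variable \<open>t\<close> codes the triple of the list, the period
    and the window size.\<close>
  define P where "P = (\<lambda>t (\<rho> :: nat \<Rightarrow> nat). certificate (fst (prod_decode t)) (fst (prod_decode (snd (prod_decode t))))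
    (snd (prod_decode (snd (prod_decode t)))) (\<rho> 0) (\<rho> (Suc 0)) (\<rho> (Suc (Suc 0))))"
  have "decidable (Suc 3) (\<lambda>\<rho>. P (\<rho> 0) (\<lambda>n. \<rho> (Suc n)))"
    unfolding P_def
    by (intro decidable_certificate computable_fst_prod_decode computable_snd_prod_decode computable_var) simp_all
  then obtain r where r: "\<And>xs t. length xs = 3 \<Longrightarrow> P t (nth xs) \<Longrightarrow> \<exists>t'. P t' (nth xs) \<and> computes r xs t'"
    using computable_minimization[where P = P and k = 3] by blast
  have "computable 1 (\<lambda>\<rho>. fst (prod_decode (\<rho> 0)))"
    by (intro computable_fst_prod_decode computable_var) simp
  then obtain s where "\<forall>xs. length xs = 1 \<longrightarrow> computes s xs (fst (prod_decode (xs ! 0)))"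
    unfolding computable_def by blast
  then have s: "computes s [t] (fst (prod_decode t))" for t
    by (elim allE[of _ "[t]"]) simp
  show "\<exists>F. \<forall>ds b a.
        \<not> (\<exists>h. line_polynomial h \<and>
              h dvd characteristic_polynomial (set ds) - of_int (int b - int a)) \<longrightarrow>
        (\<exists>ps. computes F [encode_shape ds, b, a] (encode_descriptions ps) \<and>
              (\<forall>p\<in>set ps. valid_description p) \<and>
              described_config ` set ps = coverings (set ds) b a)"
  \<comment> \<open>The program searches for a certificate and projects it to its first component,
    which already is the code of the list of descriptions.\<close>
  proof (intro exI[of _ "Comp s [r]"] allI impI)
    fix ds :: "(int \<times> int) list" and b a
    assume "\<not> (\<exists>h. line_polynomial h \<and>
              h dvd characteristic_polynomial (set ds) - of_int (int b - int a))"
    then have "finite (coverings (set ds) b a)" by (intro finite_coverings) simp_all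
    then obtain L p n where "certificate L p n (encode_shape ds) b a"
      using certificate_complete by blast
    then have "P (prod_encode (L, prod_encode (p, n))) (nth [encode_shape ds, b, a])"
      by (simp add: P_def)
    then obtain t where t: "P t (nth [encode_shape ds, b, a])" "computes r [encode_shape ds, b, a] t"
      using r[of "[encode_shape ds, b, a]"] by auto
    \<comment> \<open>The triple found may differ from the one known to exist; soundness holds for
      any certificate.\<close>
    from t(1) obtain ps where ps: "encode_descriptions ps = fst (prod_decode t)"
      "\<forall>q\<in>set ps. valid_description q" "described_config ` set ps = coverings (set ds) b a"
      using certificate_sound by (fastforce simp: P_def)
    have "computes (Comp s [r]) [encode_shape ds, b, a] (encode_descriptions ps)"
      unfolding ps(1) by (rule computes.Comp[where ys = "[t]"]) (simp_all add: t(2) s)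
    then show "\<exists>ps. computes (Comp s [r]) [encode_shape ds, b, a] (encode_descriptions ps) \<and>
              (\<forall>p\<in>set ps. valid_description p) \<and>
              described_config ` set ps = coverings (set ds) b a"
      using ps by blast
  qed
qed

end
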